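(* Let $p>1$, $q>3$, $\alpha,\beta>0$ and $T>0$. Let $g,h,l:[0,T]\times\mathbb R^3\times\mathbb R^3\to\mathbb R$ be measurable functions such that $T_1^{-(\cdot)}g$, $T_1^{-(\cdot)}h$, $T_1^{-(\cdot)}l\in X_{p,q,\alpha,\beta,T}$. Then for any $j\in\{0,1,2,3\}$ and $t\in[0,T]$, $$\left\|\int_0^tT_1^{-s}L_j(g,h,l)(s)\,ds\right\|_{p,q,\alpha,\beta}\le C_{p,q,\alpha,\beta}\,|||T_1^{-(\cdot)}g|||_{p,q,\alpha,\beta,T}\,|||T_1^{-(\cdot)}h|||_{p,q,\alpha,\beta,T}\,|||T_1^{-(\cdot)}l|||_{p,q,\alpha,\beta,T},$$ where one can take $$C_{p,q,\alpha,\beta}=\frac{16\,p\,\pi^3}{\alpha(p-1)}\left(\frac13+\frac1{q-3}\right)\max\{\beta^q,\beta^{-3q}\}.$$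
   Context: Notation: for $y\in\mathbb R^3$, $\langle y\rangle=\sqrt{1+|y|^2}$. Spaces: $X_{p,q,\alpha,\beta}$ is the space of measurable $f:\mathbb R^3\times\mathbb R^3\to\mathbb R$ with $\|f\|_{p,q,\alpha,\beta}:=\|\langle\alpha x\rangle^p\langle\beta v\rangle^qf(x,v)\|_{L^\infty}<\infty$. $X_{p,q,\alpha,\beta,T}:=C([0,T],X_{p,q,\alpha,\beta})$ with norm $|||f(\cdot)|||_{p,q,\alpha,\beta,T}:=\sup_{t\in[0,T]}\|f(t)\|_{p,q,\alpha,\beta}$. Transport: $(T_1^sg)(t,x,v):=g(t,x-sv,v)$; $T_1^{-(\cdot)}g$ denotes the map $t\mapsto T_1^{-t}g(t)$, i.e. $(t,x,v)\mapsto g(t,x+tv,v)$; likewise $T_1^{-s}L_j(g,h,l)(s)$ is $(x,v)\mapsto L_j(g,h,l)(s,x+sv,v)$. Operators (all functions evaluated at the same $(t,x)$): $L_0(g,h,l)(v)=\int_{\mathbb R^9}\delta(\Sigma)\delta(\Omega)\,g(v_1)h(v_2)l(v_3)\,dv_1dv_2dv_3$, $L_1(g,h,l)(v)=\int_{\mathbb R^9}\delta(\Sigma)\delta(\Omega)\,g(v)h(v_2)l(v_3)\,dv_1dv_2dv_3$, $L_2(g,h,l)(v)=\int_{\mathbb R^9}\delta(\Sigma)\delta(\Omega)\,g(v)h(v_1)l(v_3)\,dv_1dv_2dv_3$, $L_3(g,h,l)(v)=\int_{\mathbb R^9}\delta(\Sigma)\delta(\Omega)\,g(v)h(v_1)l(v_2)\,dv_1dv_2dv_3$,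 with $\Sigma=v+v_1-v_2-v_3$, $\Omega=|v|^2+|v_1|^2-|v_2|^2-|v_3|^2$. The delta-integrals are given explicitly by $$\int_{\mathbb R^9}\delta(\Sigma)\delta(\Omega)F(v,v_1,v_2,v_3)\,dv_1dv_2dv_3=\frac18\int_{\mathbb R^3\times\mathbb S^2}|v-v_1|\,F\Big(v,v_1,\tfrac{v+v_1}2+\tfrac{|v-v_1|}2\sigma,\tfrac{v+v_1}2-\tfrac{|v-v_1|}2\sigma\Big)d\sigma\,dv_1.$$ *)

theory Defs
  imports "HOL-Analysis.Analysis" "HOL-Probability.Essential_Supremum"
begin

type_synonym R3 = "real ^ 3"

definition jbracket :: "R3 \<Rightarrow> real" where
  "jbracket y = sqrt (1 + (norm y)\<^sup>2)"

text \<open>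
  The weighted sup-norm takes values in the extended reals; it is \<open>\<infinity>\<close> if the weighted function
  is not Lebesgue measurable (convention of \<^const>\<open>esssup\<close>) or not essentially bounded.
  Elements of the spaces below are functions, not equivalence classes; the norm and
  membership do not depend on the representative.
\<close>

definition wnorm :: "real \<Rightarrow> real \<Rightarrow> real \<Rightarrow> real \<Rightarrow> (R3 \<Rightarrow> R3 \<Rightarrow> real) \<Rightarrow> ereal" where
  "wnorm p q \<alpha> \<beta> f = esssup lebesgue (\<lambda>(x, v).
     ereal \<bar>jbracket (\<alpha> *\<^sub>R x) powr p * jbracket (\<beta> *\<^sub>R v) powr q * f x v\<bar>)"

definition Xspace :: "real \<Rightarrow> real \<Rightarrow> real \<Rightarrow> real \<Rightarrow> (R3 \<Rightarrow> R3 \<Rightarrow> real) set" where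
  "Xspace p q \<alpha> \<beta> = {f. (\<lambda>(x, v). f x v) \<in> borel_measurable lebesgue \<and> wnorm p q \<alpha> \<beta> f < \<infinity>}"

text \<open>\<open>C([0,T], X)\<close>, with continuity spelled out through the norm of \<open>X\<close>.\<close>

definition XTspace ::
    "real \<Rightarrow> real \<Rightarrow> real \<Rightarrow> real \<Rightarrow> real \<Rightarrow> (real \<Rightarrow> R3 \<Rightarrow> R3 \<Rightarrow> real) set" where
  "XTspace p q \<alpha> \<beta> T = {f. (\<forall>t\<in>{0..T}. f t \<in> Xspace p q \<alpha> \<beta>) \<and>
     (\<forall>t\<^sub>0\<in>{0..T}.
        ((\<lambda>t. wnorm p q \<alpha> \<beta> (\<lambda>x v. f t x v - f t\<^sub>0 x v)) \<longlongrightarrow> 0) (at t\<^sub>0 within {0..T}))}"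

definition wnormT ::
    "real \<Rightarrow> real \<Rightarrow> real \<Rightarrow> real \<Rightarrow> real \<Rightarrow> (real \<Rightarrow> R3 \<Rightarrow> R3 \<Rightarrow> real) \<Rightarrow> ereal" where
  "wnormT p q \<alpha> \<beta> T f = (SUP t\<in>{0..T}. wnorm p q \<alpha> \<beta> (f t))"

text \<open>\<open>T\<^sub>1\<^sup>s\<close> does not act on time, so it is defined on functions of \<open>(x, v)\<close>.\<close>

definition transport :: "real \<Rightarrow> (R3 \<Rightarrow> R3 \<Rightarrow> 'a) \<Rightarrow> R3 \<Rightarrow> R3 \<Rightarrow> 'a" where
  "transport s f = (\<lambda>x v. f (x - s *\<^sub>R v) v)"

text \<open>
  Surface measure of the unit sphere, as a measure on \<open>\<real>\<^sup>3\<close> carried by \<open>sphere 0 1\<close>.  By polar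
  coordinates \<open>dx = r\<^sup>2 dr d\<sigma>\<close>, the surface area of a set \<open>A\<close> of directions is three times the
  volume of the points \<open>x\<close> of the unit ball with \<open>x / \<bar>x\<bar> \<in> A\<close>; here \<open>sgn x = x / \<bar>x\<bar>\<close>.
\<close>

definition sphere_measure :: "R3 measure" where
  "sphere_measure = distr (density lborel (\<lambda>x. 3 * indicator (ball 0 1) x)) borel sgn"

lemma emeasure_sphere_measure:
  assumes "A \<in> sets borel"
  shows "emeasure sphere_measure A = 3 * emeasure lborel (ball 0 1 \<inter> sgn -` A)"
proof -
  have m [measurable]: "(sgn :: R3 \<Rightarrow> R3) \<in> borel_measurable borel"
    unfolding sgn_div_norm by measurable
  have A: "sgn -` A \<in> sets (borel :: R3 measure)"
    using measurable_sets [OF m assms] by simp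
  have f: "(\<lambda>x :: R3. 3 * indicator (ball 0 1) x :: ennreal) \<in> borel_measurable lborel"
    by (intro borel_measurable_times_ennreal borel_measurable_const borel_measurable_indicator) simp
  have "emeasure sphere_measure A
      = emeasure (density lborel (\<lambda>x. 3 * indicator (ball 0 1) x)) (sgn -` A)"
    unfolding sphere_measure_def using assms m by (simp add: emeasure_distr)
  also have "\<dots> = (\<integral>\<^sup>+x. 3 * indicator (ball 0 1) x * indicator (sgn -` A) x \<partial>lborel)"
    using A by (intro emeasure_density f) simp
  also have "\<dots> = (\<integral>\<^sup>+x. 3 * indicator (ball 0 1 \<inter> sgn -` A) x \<partial>lborel)"
    by (intro nn_integral_cong) (auto split: split_indicator)
  also have "\<dots> = 3 * emeasure lborel (ball 0 1 \<inter> sgn -` A)"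
    using A by (intro nn_integral_cmult_indicator) auto
  finally show ?thesis .
qed

lemma emeasure_sphere_measure_UNIV: "emeasure sphere_measure UNIV = ennreal (4 * pi)"
proof -
  have "emeasure sphere_measure UNIV = 3 * ennreal (4 / 3 * pi)"
    by (simp add: emeasure_sphere_measure emeasure_ball unit_ball_vol_3)
  also have "\<dots> = ennreal (3 * (4 / 3 * pi))"
    by (subst ennreal_mult) auto
  finally show ?thesis by simp
qed

lemma AE_sphere_measure: "AE \<sigma> in sphere_measure. \<sigma> \<in> sphere 0 1"
proof -
  have "ball 0 1 \<inter> sgn -` (- sphere 0 1) \<subseteq> {0 :: R3}"
  proof
    fix x :: R3
    assume "x \<in> ball 0 1 \<inter> sgn -` (- sphere 0 1)"
    hence "norm (sgn x) \<noteq> 1"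
      by simp
    thus "x \<in> {0}"
      by (cases "x = 0") (simp_all only: norm_sgn if_False singleton_iff)
  qed
  hence "emeasure lborel (ball 0 1 \<inter> sgn -` (- sphere 0 1) :: R3 set) \<le> emeasure lborel {0 :: R3}"
    by (intro emeasure_mono) auto
  hence "emeasure sphere_measure (- sphere 0 1) = 0"
    by (subst emeasure_sphere_measure) auto
  thus ?thesis
    by (intro AE_I [of _ _ "- sphere 0 1"]) (auto simp: sphere_measure_def)
qed

text \<open>
  The measure \<open>d\<sigma> dv\<^sub>1\<close> on \<open>\<real>\<^sup>3 \<times> S\<^sup>2\<close>, for pairs \<open>(v\<^sub>1, \<sigma>)\<close>.  It is completed, since the
  integrands are built from functions that are only Lebesgue measurable.
\<close>

definition collision_measure :: "(R3 \<times> R3) measure" where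
  "collision_measure = completion (lborel \<Otimes>\<^sub>M sphere_measure)"

definition delta_integrand :: "(R3 \<Rightarrow> R3 \<Rightarrow> R3 \<Rightarrow> R3 \<Rightarrow> real) \<Rightarrow> R3 \<Rightarrow> R3 \<times> R3 \<Rightarrow> real" where
  "delta_integrand F v = (\<lambda>(v\<^sub>1, \<sigma>).
     norm (v - v\<^sub>1) * F v v\<^sub>1 ((v + v\<^sub>1) /\<^sub>R 2 + (norm (v - v\<^sub>1) / 2) *\<^sub>R \<sigma>)
                            ((v + v\<^sub>1) /\<^sub>R 2 - (norm (v - v\<^sub>1) / 2) *\<^sub>R \<sigma>))"

text \<open>
  \<open>\<integral> \<delta>(\<Sigma>) \<delta>(\<Omega>) F(v, v\<^sub>1, v\<^sub>2, v\<^sub>3) dv\<^sub>1 dv\<^sub>2 dv\<^sub>3\<close>.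
  As usual for Bochner integrals, the value is \<open>0\<close> if the integral does not converge absolutely.
\<close>

definition delta_integral :: "(R3 \<Rightarrow> R3 \<Rightarrow> R3 \<Rightarrow> R3 \<Rightarrow> real) \<Rightarrow> R3 \<Rightarrow> real" where
  "delta_integral F v = 1 / 8 * (LINT z|collision_measure. delta_integrand F v z)"

text \<open>Only the indices \<open>j = 0, 1, 2, 3\<close> are meaningful.\<close>

definition L_density ::
    "nat \<Rightarrow> (R3 \<Rightarrow> real) \<Rightarrow> (R3 \<Rightarrow> real) \<Rightarrow> (R3 \<Rightarrow> real) \<Rightarrow> R3 \<Rightarrow> R3 \<Rightarrow> R3 \<Rightarrow> R3 \<Rightarrow> real" where
  "L_density j g h l v v\<^sub>1 v\<^sub>2 v\<^sub>3 =
     (if j = 0 then g v\<^sub>1 * h v\<^sub>2 * l v\<^sub>3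
      else if j = 1 then g v * h v\<^sub>2 * l v\<^sub>3
      else if j = 2 then g v * h v\<^sub>1 * l v\<^sub>3
      else g v * h v\<^sub>1 * l v\<^sub>2)"

text \<open>\<open>L\<^sub>j(g, h, l)\<close> at a fixed time, all functions being evaluated at the same \<open>x\<close>.\<close>

definition L_op ::
    "nat \<Rightarrow> (R3 \<Rightarrow> R3 \<Rightarrow> real) \<Rightarrow> (R3 \<Rightarrow> R3 \<Rightarrow> real) \<Rightarrow> (R3 \<Rightarrow> R3 \<Rightarrow> real) \<Rightarrow> R3 \<Rightarrow> R3 \<Rightarrow> real" where
  "L_op j g h l x v = delta_integral (L_density j (g x) (h x) (l x)) v"

text \<open>Absolute convergence of the integral defining \<open>L\<^sub>j(g, h, l)(x, v)\<close>.\<close>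

definition L_converges ::
    "nat \<Rightarrow> (R3 \<Rightarrow> R3 \<Rightarrow> real) \<Rightarrow> (R3 \<Rightarrow> R3 \<Rightarrow> real) \<Rightarrow> (R3 \<Rightarrow> R3 \<Rightarrow> real) \<Rightarrow> R3 \<Rightarrow> R3 \<Rightarrow> bool" where
  "L_converges j g h l x v \<longleftrightarrow>
     integrable collision_measure (delta_integrand (L_density j (g x) (h x) (l x)) v)"

end

theory Submission
  imports Defs
begin

text \<open>
  A bound on the norms of \<open>T\<^sub>1\<^sup>-\<^sup>s g\<close>, \<open>T\<^sub>1\<^sup>-\<^sup>s h\<close>, \<open>T\<^sub>1\<^sup>-\<^sup>s l\<close> controls the functions at the point \<open>(x + s v, v\<^sub>i)\<close> by the
  inverse of \<open>\<langle>\<alpha>(x + s (v - v\<^sub>i))\<rangle>\<^sup>p \<langle>\<beta>v\<^sub>i\<rangle>\<^sup>q\<close>.  The integrand of \<open>L\<^sub>j\<close> contains three such factors, for the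
  indices \<open>i\<close> in \<open>{0, 1, 2, 3}\<close> other than \<open>j\<close>, where \<open>v\<^sub>0 = v\<close>.

  The conservation laws make \<open>v, v\<^sub>2, v\<^sub>1, v\<^sub>3\<close> a rectangle.  The points \<open>x + s (v - v\<^sub>i)\<close> then form a rectangle
  too, and the sums of the squared distances from any point to the ends of the two diagonals agree
  (\<open>collision_energy\<close>).  With either \<open>y\<^sub>i = \<beta> v\<^sub>i\<close> or \<open>y\<^sub>i = \<alpha> (x + s (v - v\<^sub>i))\<close>, it follows that \<open>\<langle>y\<^sub>2\<rangle>\<langle>y\<^sub>3\<rangle>\<close>
  dominates both \<open>\<langle>y\<^sub>0\<rangle>\<close> and \<open>\<langle>y\<^sub>1\<rangle>\<close> (\<open>jbracket_mult_ge\<close>).  In all four cases the three weights together dominate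
  the one at \<open>(x, v)\<close> times the one for \<open>v\<^sub>1\<close> (\<open>weights_ge\<close>).  The former is the weight of the norm on the left.
  The latter leaves the integral of
  \<open>\<bar>v - v\<^sub>1\<bar> \<langle>\<alpha>(x + s (v - v\<^sub>1))\<rangle>\<^sup>-\<^sup>p \<langle>\<beta>v\<^sub>1\<rangle>\<^sup>-\<^sup>q\<close> over \<open>s\<close>, \<open>v\<^sub>1\<close> and \<open>\<sigma>\<close>.  Integrating over \<open>s\<close> first absorbs the factor
  \<open>\<bar>v - v\<^sub>1\<bar>\<close> into the arc length of a straight line and gives at most \<open>2p / (\<alpha>(p - 1))\<close>; the integral over \<open>\<sigma>\<close>
  gives \<open>4\<pi>\<close>, and that over \<open>v\<^sub>1\<close> at most \<open>4\<pi>\<beta>\<^sup>-\<^sup>3 (1/3 + 1/(q - 3))\<close> (\<open>dominating_integral\<close>).  With the factor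
  \<open>1/8\<close> this is below the stated constant (\<open>constant_bound\<close>).

  The functions are only Lebesgue measurable and their bounds hold almost everywhere, so it must also be
  known that they can be evaluated inside the collision integral.  They are replaced by Borel
  representatives that satisfy the bounds everywhere (\<open>Borel_representative\<close>).  The replacement is harmless
  because \<open>(v\<^sub>1, \<sigma>) \<mapsto> v\<^sub>i\<close>, for \<open>i \<noteq> 0\<close>, pulls null sets back to null sets (\<open>AE_velocity_notin\<close>), and so do the
  transported arguments (\<open>AE_transported_velocity_notin\<close>).
\<close>

section \<open>Decay integrals\<close>

lemma nn_integral_powr_tail:
  fixes a :: real
  assumes "a > 0"
  shows "(\<integral>\<^sup>+r. ennreal (r powr (- a - 1)) * indicator {1..} r \<partial>lborel) = ennreal (1 / a)"
proof -
  have "(\<integral>\<^sup>+r. ennreal (r powr (- a - 1)) * indicator {1..} r \<partial>lborel)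
      = 0 - (- (1 powr (- a)) / a)"
  proof (rule nn_integral_FTC_atLeast)
    show "((\<lambda>r. - (r powr (- a)) / a) has_real_derivative r powr (- a - 1)) (at r)" if "1 \<le> r" for r :: real
      using that assms by (auto intro!: derivative_eq_intros simp: powr_diff)
    have "((\<lambda>r::real. r powr (- a)) \<longlongrightarrow> 0) at_top"
      using assms by (intro tendsto_neg_powr filterlim_ident) auto
    then show "((\<lambda>r::real. - (r powr (- a)) / a) \<longlongrightarrow> 0) at_top"
      using tendsto_divide [OF tendsto_minus tendsto_const, of _ 0 at_top a] assms by fastforce
  qed auto
  then show ?thesis by simp
qed

text \<open>
  The layer-cake formula for the single function \<open>y powr (- c)\<close>: it turns an integral of a negative
  power into an integral of volumes of sublevel sets.
\<close>

lemma powr_neg_layer_cake: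
  fixes c y :: real
  assumes "c > 0" and "y \<ge> 1"
  shows "ennreal (y powr (- c)) =
    (\<integral>\<^sup>+r. ennreal (c * r powr (- c - 1)) * indicator {1..} r * indicator {r. y \<le> r} r \<partial>lborel)"
proof -
  have "(\<integral>\<^sup>+r. ennreal (c * r powr (- c - 1)) * indicator {1..} r * indicator {r. y \<le> r} r \<partial>lborel)
      = (\<integral>\<^sup>+r. ennreal (c * r powr (- c - 1)) * indicator {y..} r \<partial>lborel)"
    using assms by (intro nn_integral_cong) (auto split: split_indicator)
  also have "\<dots> = 0 - (- (y powr (- c)))"
  proof (rule nn_integral_FTC_atLeast)
    show "((\<lambda>r. - (r powr (- c))) has_real_derivative c * r powr (- c - 1)) (at r)" if "y \<le> r" for r :: real
      using that assms by (auto intro!: derivative_eq_intros simp: powr_diff)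
    have "((\<lambda>r::real. r powr (- c)) \<longlongrightarrow> 0) at_top"
      using assms by (intro tendsto_neg_powr filterlim_ident) auto
    then show "((\<lambda>r::real. - (r powr (- c))) \<longlongrightarrow> 0) at_top"
      using tendsto_minus by fastforce
  qed (use assms in auto)
  finally show ?thesis by simp
qed

text \<open>
  Integrating the layer-cake formula and exchanging the integrals leaves
  \<open>\<integral> c r\<^sup>-\<^sup>c\<^sup>-\<^sup>1 K r\<^sup>m dr\<close> over \<open>r \<ge> 1\<close>, where \<open>K r\<^sup>m\<close> bounds the volume of \<open>{\<phi> \<le> r}\<close>.  Only the growth
  of sublevel sets matters, so the same bound covers the time integral (\<open>m = 1\<close>, intervals) and the
  velocity integral (\<open>m = 3\<close>, balls).
\<close>

lemma nn_integral_powr_neg_le: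
  fixes \<phi> :: "'a \<Rightarrow> real" and K c m :: real
  assumes "sigma_finite_measure M"
    and \<phi> [measurable]: "\<phi> \<in> borel_measurable M"
    and ge1: "\<And>x. \<phi> x \<ge> 1"
    and K: "K \<ge> 0" and c: "c > m" "m \<ge> 0"
    and growth: "\<And>r. r \<ge> 1 \<Longrightarrow> emeasure M {x \<in> space M. \<phi> x \<le> r} \<le> ennreal (K * r powr m)"
  shows "(\<integral>\<^sup>+x. ennreal (\<phi> x powr (- c)) \<partial>M) \<le> ennreal (K * (c / (c - m)))"
proof -
  interpret sigma_finite_measure M by fact
  interpret P: pair_sigma_finite M lborel ..
  have "(\<integral>\<^sup>+x. ennreal (\<phi> x powr (- c)) \<partial>M)
    = (\<integral>\<^sup>+x. \<integral>\<^sup>+r. ennreal (c * r powr (- c - 1)) * indicator {1..} r * indicator {r. \<phi> x \<le> r} r \<partial>lborel \<partial>M)"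
    using ge1 c by (intro nn_integral_cong powr_neg_layer_cake) auto
  also have "\<dots> = (\<integral>\<^sup>+r. \<integral>\<^sup>+x. ennreal (c * r powr (- c - 1)) * indicator {1..} r * indicator {r. \<phi> x \<le> r} r \<partial>M \<partial>lborel)"
    by (rule P.Fubini'[symmetric]) (simp add: indicator_def)
  also have "\<dots> = (\<integral>\<^sup>+r. ennreal (c * r powr (- c - 1)) * indicator {1..} r * emeasure M {x \<in> space M. \<phi> x \<le> r} \<partial>lborel)"
  proof (rule nn_integral_cong)
    fix r :: real
    have "(\<integral>\<^sup>+x. ennreal (c * r powr (- c - 1)) * indicator {1..} r * indicator {r. \<phi> x \<le> r} r \<partial>M)
       = (\<integral>\<^sup>+x. ennreal (c * r powr (- c - 1)) * indicator {1..} r * indicator {x \<in> space M. \<phi> x \<le> r} x \<partial>M)"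
      by (intro nn_integral_cong) (auto split: split_indicator)
    also have "\<dots> = ennreal (c * r powr (- c - 1)) * indicator {1..} r * emeasure M {x \<in> space M. \<phi> x \<le> r}"
      by (intro nn_integral_cmult_indicator) measurable
    finally show "(\<integral>\<^sup>+x. ennreal (c * r powr (- c - 1)) * indicator {1..} r * indicator {r. \<phi> x \<le> r} r \<partial>M)
       = ennreal (c * r powr (- c - 1)) * indicator {1..} r * emeasure M {x \<in> space M. \<phi> x \<le> r}" .
  qed
  also have "\<dots> \<le> (\<integral>\<^sup>+r. ennreal (c * K) * (ennreal (r powr (- (c - m) - 1)) * indicator {1..} r) \<partial>lborel)"
  proof (rule nn_integral_mono)
    fix r :: real
    show "ennreal (c * r powr (- c - 1)) * indicator {1..} r * emeasure M {x \<in> space M. \<phi> x \<le> r}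
        \<le> ennreal (c * K) * (ennreal (r powr (- (c - m) - 1)) * indicator {1..} r)"
    proof (cases "r \<ge> 1")
      case True
      have "ennreal (c * r powr (- c - 1)) * emeasure M {x \<in> space M. \<phi> x \<le> r}
          \<le> ennreal (c * r powr (- c - 1)) * ennreal (K * r powr m)"
        by (intro mult_left_mono growth True) simp
      also have "\<dots> = ennreal ((c * r powr (- c - 1)) * (K * r powr m))"
        using K c by (subst ennreal_mult) auto
      also have "(c * r powr (- c - 1)) * (K * r powr m) = c * K * r powr (- (c - m) - 1)"
        using True by (simp add: powr_add [symmetric] algebra_simps)
      also have "ennreal \<dots> = ennreal (c * K) * ennreal (r powr (- (c - m) - 1))"
        using K c by (subst ennreal_mult) auto
      finally show ?thesis using True by simp
    qed simp
  qed
  also have "\<dots> = ennreal (c * K) * ennreal (1 / (c - m))"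
    using c by (subst nn_integral_cmult) (auto simp only: nn_integral_powr_tail, measurable)
  also have "\<dots> = ennreal (K * (c / (c - m)))"
    using K c by (subst ennreal_mult [symmetric]) auto
  finally show ?thesis .
qed

lemma jbracket_ge_1: "jbracket y \<ge> 1"
  by (simp add: jbracket_def)

lemma jbracket_ge_norm: "norm y \<le> jbracket y"
  unfolding jbracket_def by (rule real_le_rsqrt) simp

lemma borel_measurable_jbracket [measurable]: "jbracket \<in> borel_measurable borel"
  unfolding jbracket_def[abs_def] by measurable

text \<open>
  The sublevel set \<open>{v. \<langle>\<beta>v\<rangle> \<le> r}\<close> lies in a ball of radius \<open>r / \<beta>\<close>, hence the factor \<open>\<beta>\<^sup>-\<^sup>3\<close>.
\<close>

lemma velocity_decay_integral:
  assumes "q > 3" and "\<beta> > 0"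
  shows "(\<integral>\<^sup>+v. ennreal (jbracket (\<beta> *\<^sub>R v) powr (- q)) \<partial>lborel)
    \<le> ennreal (4 * pi / \<beta> ^ 3 * (1 / 3 + 1 / (q - 3)))"
proof -
  have "(\<integral>\<^sup>+v. ennreal (jbracket (\<beta> *\<^sub>R v) powr (- q)) \<partial>lborel)
     \<le> ennreal (4 / 3 * pi / \<beta> ^ 3 * (q / (q - 3)))"
  proof (rule nn_integral_powr_neg_le)
    fix r :: real assume r: "r \<ge> 1"
    have "{v \<in> space lborel. jbracket (\<beta> *\<^sub>R v) \<le> r} \<subseteq> cball 0 (r / \<beta>)"
    proof
      fix v assume "v \<in> {v \<in> space lborel. jbracket (\<beta> *\<^sub>R v) \<le> r}"
      then have "norm (\<beta> *\<^sub>R v) \<le> r"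
        using jbracket_ge_norm [of "\<beta> *\<^sub>R v"] by simp
      then show "v \<in> cball 0 (r / \<beta>)"
        using assms by (simp add: field_simps)
    qed
    then have "emeasure lborel {v \<in> space lborel. jbracket (\<beta> *\<^sub>R v) \<le> r}
        \<le> emeasure lborel (cball (0::R3) (r / \<beta>))"
      by (intro emeasure_mono) auto
    also have "\<dots> = ennreal (4 / 3 * pi / \<beta> ^ 3 * r powr 3)"
      using r assms by (simp add: emeasure_cball unit_ball_vol_3 powr_numeral power_divide)
    finally show "emeasure lborel {v \<in> space lborel. jbracket (\<beta> *\<^sub>R v) \<le> r}
        \<le> ennreal (4 / 3 * pi / \<beta> ^ 3 * r powr 3)" .
  qed (use assms jbracket_ge_1 in \<open>auto intro: sigma_finite_lborel\<close>)
  also have "4 / 3 * pi / \<beta> ^ 3 * (q / (q - 3)) = 4 * pi / \<beta> ^ 3 * (1 / 3 + 1 / (q - 3))"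
    using assms by (simp add: field_simps)
  finally show ?thesis .
qed

text \<open>
  Along the line \<open>s \<mapsto> x + s u\<close> the speed \<open>\<bar>u\<bar>\<close> multiplies the integrand and divides the length of the
  time interval spent in a ball.  The two cancel, which makes the bound uniform in \<open>x\<close> and \<open>u\<close>; this
  is how the collision kernel \<open>\<bar>v - v\<^sub>1\<bar>\<close>, unbounded for large relative velocities, is absorbed.
\<close>

lemma time_decay_integral:
  assumes "p > 1" and "\<alpha> > 0"
  shows "(\<integral>\<^sup>+s. ennreal (norm u * jbracket (\<alpha> *\<^sub>R (x + s *\<^sub>R u)) powr (- p)) \<partial>lborel)
    \<le> ennreal (2 * p / (\<alpha> * (p - 1)))"
proof (cases "u = 0")
  case False
  \<comment> \<open>It suffices to follow the component along the direction of motion, which is affine in \<open>s\<close>.\<close>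
  define e where "e = sgn u"
  have "norm e = 1" using False by (simp add: e_def norm_sgn)
  have ue: "u \<bullet> e = norm u"
    using False by (simp add: e_def sgn_div_norm power2_norm_eq_inner [symmetric] power2_eq_square)
  have "(\<integral>\<^sup>+s. ennreal (jbracket (\<alpha> *\<^sub>R (x + s *\<^sub>R u)) powr (- p)) \<partial>lborel)
    \<le> ennreal (2 / (\<alpha> * norm u) * (p / (p - 1)))"
  proof (rule nn_integral_powr_neg_le)
    fix r :: real assume r: "r \<ge> 1"
    have "{s \<in> space lborel. jbracket (\<alpha> *\<^sub>R (x + s *\<^sub>R u)) \<le> r}
        \<subseteq> cball (- (x \<bullet> e) / norm u) (r / (\<alpha> * norm u))"
    proof
      fix s :: real assume "s \<in> {s \<in> space lborel. jbracket (\<alpha> *\<^sub>R (x + s *\<^sub>R u)) \<le> r}"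
      then have "norm (\<alpha> *\<^sub>R (x + s *\<^sub>R u)) \<le> r"
        using jbracket_ge_norm [of "\<alpha> *\<^sub>R (x + s *\<^sub>R u)"] unfolding mem_Collect_eq by linarith
      then have "\<alpha> * norm (x + s *\<^sub>R u) \<le> r" using assms by simp
      moreover have "\<bar>(x + s *\<^sub>R u) \<bullet> e\<bar> \<le> norm (x + s *\<^sub>R u)"
        using Cauchy_Schwarz_ineq2 [of "x + s *\<^sub>R u" e] \<open>norm e = 1\<close> by simp
      ultimately have "\<alpha> * \<bar>x \<bullet> e + s * norm u\<bar> \<le> r"
        using assms ue by (smt (verit) inner_add_left inner_scaleR_left mult_left_mono)
      moreover have "x \<bullet> e + s * norm u = norm u * (s - (- (x \<bullet> e) / norm u))"
        using False by (simp add: field_simps)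
      ultimately have "\<alpha> * (norm u * \<bar>s - (- (x \<bullet> e) / norm u)\<bar>) \<le> r"
        by (simp add: abs_mult)
      then show "s \<in> cball (- (x \<bullet> e) / norm u) (r / (\<alpha> * norm u))"
        using assms False by (simp add: dist_real_def abs_minus_commute pos_le_divide_eq mult_ac)
    qed
    then have "emeasure lborel {s \<in> space lborel. jbracket (\<alpha> *\<^sub>R (x + s *\<^sub>R u)) \<le> r}
        \<le> emeasure lborel (cball (- (x \<bullet> e) / norm u) (r / (\<alpha> * norm u)))"
      by (intro emeasure_mono) auto
    also have "\<dots> = ennreal (2 / (\<alpha> * norm u) * r powr 1)"
      using r assms by (simp add: emeasure_cball)
    finally show "emeasure lborel {s \<in> space lborel. jbracket (\<alpha> *\<^sub>R (x + s *\<^sub>R u)) \<le> r}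
        \<le> ennreal (2 / (\<alpha> * norm u) * r powr 1)" .
  qed (use assms jbracket_ge_1 in \<open>auto intro: sigma_finite_lborel\<close>)
  then have "ennreal (norm u) * (\<integral>\<^sup>+s. ennreal (jbracket (\<alpha> *\<^sub>R (x + s *\<^sub>R u)) powr (- p)) \<partial>lborel)
    \<le> ennreal (norm u) * ennreal (2 / (\<alpha> * norm u) * (p / (p - 1)))"
    by (intro mult_left_mono) auto
  also have "\<dots> = ennreal (2 * p / (\<alpha> * (p - 1)))"
    using assms False by (subst ennreal_mult [symmetric]) auto
  finally show ?thesis
    by (subst (asm) nn_integral_cmult [symmetric]) (auto simp: ennreal_mult)
qed simp

section \<open>Conservation laws and weights\<close>

definition outgoing :: "R3 \<Rightarrow> R3 \<times> R3 \<Rightarrow> R3" where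
  "outgoing v = (\<lambda>(v\<^sub>1, \<sigma>). (v + v\<^sub>1) /\<^sub>R 2 + (norm (v - v\<^sub>1) / 2) *\<^sub>R \<sigma>)"

text \<open>
  The four velocities \<open>v, v\<^sub>1, v\<^sub>2, v\<^sub>3\<close> of a collision, indexed by \<open>0, 1, 2, 3\<close>, so that \<open>L\<^sub>j\<close> has its three
  arguments at the velocities with index other than \<open>j\<close>.  The velocity \<open>v\<^sub>3\<close> is \<open>v\<^sub>2\<close> for the
  opposite direction \<open>- \<sigma>\<close>.
\<close>

definition velocity :: "nat \<Rightarrow> R3 \<Rightarrow> R3 \<times> R3 \<Rightarrow> R3" where
  "velocity i v z = (if i = 0 then v else if i = 1 then fst z
     else if i = 2 then outgoing v z else outgoing v (fst z, - snd z))"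

lemma parallelogram: "(norm (m + d))\<^sup>2 + (norm (m - d))\<^sup>2 = 2 * (norm m)\<^sup>2 + 2 * (norm (d :: 'a :: real_inner))\<^sup>2"
  by (simp add: power2_norm_eq_inner inner_diff inner_add inner_commute)

text \<open>
  Momentum and energy conservation say that \<open>v, v\<^sub>2, v\<^sub>1, v\<^sub>3\<close> are the corners of a rectangle with
  diagonals \<open>v v\<^sub>1\<close> and \<open>v\<^sub>2 v\<^sub>3\<close>.  The sums of the squared distances of a point to the ends of the two
  diagonals agree, since the diagonals have the same midpoint \<open>m\<close> and the same length.  With
  \<open>c = 0\<close> this gives the comparison of velocity weights, and with \<open>c = \<alpha> (x + s v)\<close> and
  \<open>k = - \<alpha> s\<close> that of position weights along the characteristics.
\<close>

lemma collision_energy: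
  assumes "norm \<sigma> = 1"
  shows "(norm (c + k *\<^sub>R velocity 2 v (v\<^sub>1, \<sigma>)))\<^sup>2 + (norm (c + k *\<^sub>R velocity 3 v (v\<^sub>1, \<sigma>)))\<^sup>2
       = (norm (c + k *\<^sub>R velocity 0 v (v\<^sub>1, \<sigma>)))\<^sup>2 + (norm (c + k *\<^sub>R velocity 1 v (v\<^sub>1, \<sigma>)))\<^sup>2"
proof -
  define m where "m = c + (k / 2) *\<^sub>R (v + v\<^sub>1)"
  define d where "d = (k * norm (v - v\<^sub>1) / 2) *\<^sub>R \<sigma>"
  define d' where "d' = (k / 2) *\<^sub>R (v - v\<^sub>1)"
  define n where "n = norm (v - v\<^sub>1)"
  have 1: "c + k *\<^sub>R velocity 2 v (v\<^sub>1, \<sigma>) = m + d" "c + k *\<^sub>R velocity 3 v (v\<^sub>1, \<sigma>) = m - d"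
    unfolding velocity_def outgoing_def m_def d_def n_def [symmetric]
    by (simp_all add: vec_eq_iff field_simps n_def)
  have 2: "c + k *\<^sub>R velocity 0 v (v\<^sub>1, \<sigma>) = m + d'" "c + k *\<^sub>R velocity 1 v (v\<^sub>1, \<sigma>) = m - d'"
    unfolding velocity_def m_def d'_def by (simp_all add: vec_eq_iff field_simps)
  have "norm d = norm d'"
    using assms by (simp add: d_def d'_def abs_mult)
  then show ?thesis
    unfolding 1 2 parallelogram by simp
qed

text \<open>
  Expanding \<open>\<langle>a\<rangle>\<^sup>2\<langle>b\<rangle>\<^sup>2\<close> gives at least \<open>1 + \<bar>a\<bar>\<^sup>2 + \<bar>b\<bar>\<^sup>2 = 1 + \<bar>c\<bar>\<^sup>2 + \<bar>d\<bar>\<^sup>2\<close>.  The product of two weights on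
  one diagonal of a rectangle thus dominates each single weight on the other diagonal.  The stronger
  \<open>\<langle>c\<rangle>\<langle>d\<rangle> \<le> \<langle>a\<rangle>\<langle>b\<rangle>\<close> is false in general.
\<close>

lemma jbracket_mult_ge:
  assumes "(norm a)\<^sup>2 + (norm b)\<^sup>2 = (norm c)\<^sup>2 + (norm d)\<^sup>2"
  shows "jbracket c \<le> jbracket a * jbracket b" "jbracket d \<le> jbracket a * jbracket b"
proof -
  have "(1 + (norm a)\<^sup>2) * (1 + (norm b)\<^sup>2) = 1 + ((norm a)\<^sup>2 + (norm b)\<^sup>2) + (norm a)\<^sup>2 * (norm b)\<^sup>2"
    by (simp add: algebra_simps)
  then have *: "1 + (norm c)\<^sup>2 \<le> (1 + (norm a)\<^sup>2) * (1 + (norm b)\<^sup>2)"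
    "1 + (norm d)\<^sup>2 \<le> (1 + (norm a)\<^sup>2) * (1 + (norm b)\<^sup>2)"
    unfolding assms by simp_all
  show "jbracket c \<le> jbracket a * jbracket b" "jbracket d \<le> jbracket a * jbracket b"
    unfolding jbracket_def real_sqrt_mult [symmetric] using * by simp_all
qed

section \<open>Null sets and the collision parametrization\<close>

lemma sets_sphere_measure [simp, measurable_cong]: "sets sphere_measure = sets borel"
  by (simp add: sphere_measure_def)

lemma space_sphere_measure [simp]: "space sphere_measure = UNIV"
  by (simp add: sphere_measure_def)

lemma sigma_finite_sphere_measure: "sigma_finite_measure sphere_measure"
proof -
  interpret finite_measure sphere_measure
    by standard (simp add: emeasure_sphere_measure_UNIV)
  show ?thesis ..
qed

interpretation sphere: sigma_finite_measure sphere_measure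
  by (rule sigma_finite_sphere_measure)

interpretation outgoing_pair: pair_sigma_finite "lborel :: R3 measure" sphere_measure ..

abbreviation outgoing_measure :: "(R3 \<times> R3) measure" where
  "outgoing_measure \<equiv> lborel \<Otimes>\<^sub>M sphere_measure"

lemma sigma_finite_outgoing_measure: "sigma_finite_measure outgoing_measure"
  by (rule outgoing_pair.sigma_finite_measure_axioms)

lemma AE_outgoing_measure_sphere: "AE z in outgoing_measure. norm (snd z) = 1"
proof (rule outgoing_pair.AE_pair_measure)
  show "AE x in lborel. AE y in sphere_measure. norm (snd (x :: R3, y)) = 1"
    using AE_sphere_measure by simp
qed measurable

lemma measurable_velocity [measurable]:
  "(\<lambda>(v, z). velocity i v z) \<in> borel \<Otimes>\<^sub>M (borel \<Otimes>\<^sub>M borel) \<rightarrow>\<^sub>M borel"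
  unfolding velocity_def outgoing_def split_beta by measurable

text \<open>
  For a fixed direction \<open>\<sigma>\<close> the map \<open>v\<^sub>1 \<mapsto> v\<^sub>2\<close> has derivative \<open>u \<mapsto> (u + (e \<bullet> u) \<sigma>) / 2\<close> with
  \<open>e = (v\<^sub>1 - v) / \<bar>v\<^sub>1 - v\<bar>\<close>, which is injective unless \<open>e = - \<sigma>\<close>.  So preimages of null sets are null
  away from the ray \<open>v - \<real>\<^sub>+ \<sigma>\<close>, and that ray is null itself.
\<close>

lemma AE_outgoing_notin:
  assumes M: "M \<in> null_sets lborel" and \<sigma>: "norm \<sigma> = 1"
  shows "AE v\<^sub>1 in lborel. outgoing v (v\<^sub>1, \<sigma>) \<notin> M"
proof -
  \<comment> \<open>The points where the derivative exists and is injective: \<open>w \<noteq> v\<close> and \<open>e \<noteq> - \<sigma>\<close>.\<close>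
  define S where "S = {w. norm (w - v) + (w - v) \<bullet> \<sigma> \<noteq> 0}"
  have M': "negligible M"
    using M by (simp add: negligible_iff_null_sets null_sets_completionI)
  have 1: "negligible {w \<in> S. outgoing v (w, \<sigma>) \<in> M}"
  proof (rule negligible_differentiable_vimage [OF M'])
    fix w assume w: "w \<in> S"
    then have wv: "w \<noteq> v" by (auto simp: S_def)
    have "((\<lambda>w. (v + w) /\<^sub>R 2 + (norm (w - v) / 2) *\<^sub>R \<sigma>) has_derivative
        (\<lambda>u. u /\<^sub>R 2 + (sgn (w - v) \<bullet> u / 2) *\<^sub>R \<sigma>)) (at w within S)"
    proof -
      have "((\<lambda>w. w - v) has_derivative (\<lambda>u. u)) (at w within S)"
        by (auto intro!: derivative_eq_intros)
      moreover have "(norm has_derivative (\<lambda>u. u \<bullet> sgn (w - v))) (at (w - v))"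
        using wv by (intro has_derivative_norm) simp
      ultimately have "((\<lambda>w. norm (w - v)) has_derivative (\<lambda>u. u \<bullet> sgn (w - v))) (at w within S)"
        by (rule has_derivative_compose)
      then show ?thesis by (auto intro!: derivative_eq_intros simp: inner_commute)
    qed
    then show "((\<lambda>w. outgoing v (w, \<sigma>)) has_derivative
        (\<lambda>u. u /\<^sub>R 2 + (sgn (w - v) \<bullet> u / 2) *\<^sub>R \<sigma>)) (at w within S)"
      by (simp add: outgoing_def norm_minus_commute)
    have lin: "linear (\<lambda>u. u /\<^sub>R 2 + (sgn (w - v) \<bullet> u / 2) *\<^sub>R \<sigma>)"
      by (rule linearI) (simp_all add: algebra_simps inner_add_right add_divide_distrib)
    show "inj (\<lambda>u. u /\<^sub>R 2 + (sgn (w - v) \<bullet> u / 2) *\<^sub>R \<sigma>)"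
      unfolding linear_injective_0 [OF lin]
    proof (intro allI impI)
      fix u assume "u /\<^sub>R 2 + (sgn (w - v) \<bullet> u / 2) *\<^sub>R \<sigma> = 0"
      then have "2 *\<^sub>R (u /\<^sub>R 2 + (sgn (w - v) \<bullet> u / 2) *\<^sub>R \<sigma>) = 0" by simp
      then have u: "u + (sgn (w - v) \<bullet> u) *\<^sub>R \<sigma> = 0"
        by (simp add: scaleR_add_right)
      then have "sgn (w - v) \<bullet> (u + (sgn (w - v) \<bullet> u) *\<^sub>R \<sigma>) = 0" by simp
      then have "(sgn (w - v) \<bullet> u) * (1 + sgn (w - v) \<bullet> \<sigma>) = 0"
        by (simp add: inner_add_right algebra_simps)
      moreover have "1 + sgn (w - v) \<bullet> \<sigma> = (norm (w - v) + (w - v) \<bullet> \<sigma>) / norm (w - v)"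
        using wv unfolding sgn_div_norm inner_scaleR_left by (simp add: add_divide_distrib divide_inverse distrib_right)
      then have "1 + sgn (w - v) \<bullet> \<sigma> \<noteq> 0"
        using w wv by (simp add: S_def)
      ultimately show "u = 0" using u by simp
    qed
  qed
  have 2: "negligible (- S)"
  proof (rule negligible_subset)
    show "negligible ((+) v ` span {\<sigma>})"
      by (intro negligible_translation negligible_lowdim) (simp add: \<sigma>)
    show "- S \<subseteq> (+) v ` span {\<sigma>}"
    proof
      fix w assume "w \<in> - S"
      then have "(w - v) \<bullet> (- \<sigma>) = norm (w - v) * norm (- \<sigma>)"
        by (simp add: S_def \<sigma>)
      then have "w - v = norm (w - v) *\<^sub>R (- \<sigma>)"
        unfolding norm_cauchy_schwarz_eq using \<sigma> by simp
      then have "w - v \<in> span {\<sigma>}"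
        by (metis scaleR_minus_right span_base span_neg span_scale insertI1)
      then show "w \<in> (+) v ` span {\<sigma>}"
        by (rule rev_image_eqI) simp
    qed
  qed
  have "negligible {w. outgoing v (w, \<sigma>) \<in> M}"
    by (rule negligible_subset [OF negligible_Un [OF 1 2]]) auto
  then have "AE w in lebesgue. w \<notin> {w. outgoing v (w, \<sigma>) \<in> M}"
    unfolding negligible_iff_null_sets by (rule AE_not_in)
  then show ?thesis
    unfolding AE_completion_iff by simp
qed

lemma AE_velocity_notin:
  assumes M: "M \<in> null_sets lborel" and i: "i \<noteq> 0"
  shows "AE z in outgoing_measure. velocity i v z \<notin> M"
proof (rule outgoing_pair.AE_pair_measure)
  have [measurable]: "M \<in> sets borel" using M by auto
  show m: "{z \<in> space outgoing_measure. velocity i v z \<notin> M}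
      \<in> sets outgoing_measure"
    by measurable
  have "AE \<sigma> in sphere_measure. AE v\<^sub>1 in lborel. velocity i v (v\<^sub>1, \<sigma>) \<notin> M"
    using AE_sphere_measure
  proof eventually_elim
    case (elim \<sigma>)
    consider "i = 1" | "i = 2" | "i \<noteq> 1" "i \<noteq> 2" by blast
    then show ?case
    proof cases
      case 1
      then show ?thesis using AE_not_in [OF M] by (simp add: velocity_def)
    next
      case 2
      then show ?thesis using AE_outgoing_notin [OF M, of \<sigma>] elim by (simp add: velocity_def)
    next
      case 3
      then show ?thesis using AE_outgoing_notin [OF M, of "- \<sigma>"] elim i by (simp add: velocity_def)
    qed
  qed
  then show "AE v\<^sub>1 in lborel. AE \<sigma> in sphere_measure. velocity i v (v\<^sub>1, \<sigma>) \<notin> M"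
    using m by (subst outgoing_pair.AE_commute) simp_all
qed

text \<open>
  Null sets of the transported arguments are visible when \<open>x\<close> is integrated first, for fixed \<open>s\<close> and \<open>v\<close>,
  whereas the conclusion is wanted for almost every \<open>(x, v)\<close>, and then almost every \<open>s\<close>.
\<close>

lemma AE_reorder:
  fixes F :: "real \<Rightarrow> R3 \<Rightarrow> R3 \<Rightarrow> ennreal"
  assumes F [measurable]: "(\<lambda>(s, x, v). F s x v) \<in> borel_measurable borel"
    and ae: "AE s in lborel. AE v in lborel. AE x in lborel. F s x v = 0"
  shows "AE (x, v) in lborel. AE s in lborel. F s x v = 0"
proof -
  have F' [measurable]: "(\<lambda>(s, x, v). F s x v) \<in> borel_measurable (borel \<Otimes>\<^sub>M borel \<Otimes>\<^sub>M borel)"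
    using F by (simp add: borel_prod)
  have "(\<lambda>(z, s). (s, fst z, snd z)) \<in> (borel \<Otimes>\<^sub>M borel) \<Otimes>\<^sub>M borel \<rightarrow>\<^sub>M borel \<Otimes>\<^sub>M borel \<Otimes>\<^sub>M borel"
    by measurable
  from measurable_compose [OF this F']
  have [measurable]: "(\<lambda>(z, s). F s (fst z) (snd z)) \<in> borel_measurable (borel \<Otimes>\<^sub>M borel)"
    by (simp add: borel_prod split_beta')
  have "(\<integral>\<^sup>+z. \<integral>\<^sup>+s. F s (fst z) (snd z) \<partial>lborel \<partial>lborel)
      = (\<integral>\<^sup>+s. \<integral>\<^sup>+z. F s (fst z) (snd z) \<partial>lborel \<partial>lborel)"
    by (rule lborel_pair.Fubini' [symmetric]) simp
  also have "\<dots> = (\<integral>\<^sup>+s. \<integral>\<^sup>+v. \<integral>\<^sup>+x. F s x v \<partial>lborel \<partial>lborel \<partial>lborel)"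
  proof (intro nn_integral_cong)
    fix s :: real
    have [measurable]: "(\<lambda>z. F s (fst z) (snd z)) \<in> borel_measurable (lborel \<Otimes>\<^sub>M lborel)"
      by measurable
    show "(\<integral>\<^sup>+z. F s (fst z) (snd z) \<partial>lborel) = (\<integral>\<^sup>+v. \<integral>\<^sup>+x. F s x v \<partial>lborel \<partial>lborel)"
      unfolding lborel_prod [symmetric] by (subst lborel_pair.nn_integral_snd [symmetric]) simp_all
  qed
  also have "\<dots> = (\<integral>\<^sup>+(s::real). 0 \<partial>lborel)"
  proof (rule nn_integral_cong_AE)
    show "AE s in lborel. (\<integral>\<^sup>+v. \<integral>\<^sup>+x. F s x v \<partial>lborel \<partial>lborel) = 0"
      using ae
    proof eventually_elim
      case (elim s)
      have "(\<integral>\<^sup>+v. \<integral>\<^sup>+x. F s x v \<partial>lborel \<partial>lborel) = (\<integral>\<^sup>+(v::R3). 0 \<partial>lborel)"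
        by (intro nn_integral_cong_AE, use elim in eventually_elim) (simp cong: nn_integral_cong_AE)
      then show ?case by simp
    qed
  qed
  finally have "(\<integral>\<^sup>+z. \<integral>\<^sup>+s. F s (fst z) (snd z) \<partial>lborel \<partial>lborel) = 0"
    by simp
  then have "AE z in lborel. (\<integral>\<^sup>+s. F s (fst z) (snd z) \<partial>lborel) = 0"
    by (subst (asm) nn_integral_0_iff_AE) simp_all
  then have "AE z in lborel. AE s in lborel. F s (fst z) (snd z) = 0"
    by eventually_elim (subst (asm) nn_integral_0_iff_AE, simp_all)
  then show ?thesis by (simp add: split_beta')
qed

lemma AE_shift:
  fixes a :: "'a :: euclidean_space"
  assumes "AE x in lborel. P x"
  shows "AE x in lborel. P (x + a)"
proof -
  have "AE x in distr lborel borel ((+) a). P x"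
    using assms unfolding lborel_distr_plus .
  then obtain N where N: "N \<in> null_sets (distr lborel borel ((+) a))" "{x. \<not> P x} \<subseteq> N"
    by (auto simp: eventually_ae_filter)
  have "(+) a -` N \<in> null_sets lborel"
    using N(1) by (subst (asm) null_sets_distr_iff) auto
  then show ?thesis
    by (rule AE_I') (use N(2) in \<open>auto simp: add.commute\<close>)
qed

text \<open>
  Functions that are only determined almost everywhere can therefore be evaluated inside the collision
  integral along characteristics.  For \<open>i = 0\<close> the arguments do not involve \<open>z\<close> and \<open>(x, v)\<close> is merely
  sheared; otherwise \<open>v\<close> is a parameter, \<open>x\<close> is shifted, and \<open>z\<close> provides the velocity.
\<close>

lemma AE_transported_velocity_notin:
  fixes N :: "(real \<times> R3 \<times> R3) set"
  assumes N: "N \<in> null_sets lborel"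
  shows "AE (x, v) in lborel. AE s in lborel. AE z in outgoing_measure.
    (s, x + s *\<^sub>R v, velocity i v z) \<notin> N"
proof -
  have [measurable]: "N \<in> sets (borel \<Otimes>\<^sub>M borel \<Otimes>\<^sub>M borel)"
    unfolding borel_prod using null_setsD2 [OF N] by simp
  define F where "F s x v = (\<integral>\<^sup>+z. indicator N (s, x + s *\<^sub>R v, velocity i v z)
      \<partial>outgoing_measure)" for s x v
  have F0: "F s x v = 0 \<longleftrightarrow> (AE z in outgoing_measure. (s, x + s *\<^sub>R v, velocity i v z) \<notin> N)" for s x v
    unfolding F_def by (subst nn_integral_0_iff_AE) (auto simp: indicator_def)
  have Fm: "(\<lambda>(s, x, v). F s x v) \<in> borel_measurable (borel \<Otimes>\<^sub>M borel \<Otimes>\<^sub>M borel)"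
    unfolding F_def split_beta' by measurable
  then have Fm': "(\<lambda>(s, x, v). F s x v) \<in> borel_measurable borel"
    by (simp add: borel_prod)
  have "AE s in lborel. AE y in lborel. (s, y) \<notin> N"
    by (rule lborel_pair.AE_pair) (unfold lborel_prod, rule AE_not_in [OF N])
  then have N1: "AE s in lborel. AE y in lborel. AE w in lborel. (s, y, w) \<notin> N"
    by eventually_elim (rule lborel_pair.AE_pair, unfold lborel_prod)
  have "AE s in lborel. AE v in lborel. AE x in lborel. F s x v = 0"
  proof (cases "i = 0")
    case True
    from N1 show ?thesis
    proof eventually_elim
      case (elim s)
      have "{z \<in> space (lborel \<Otimes>\<^sub>M lborel). (s, fst z, snd z) \<notin> N} \<in> sets (lborel \<Otimes>\<^sub>M lborel)"
        by measurable
      from lborel_pair.AE_commute [of "\<lambda>x v. (s, x, v) \<notin> N", OF this] elim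
      have "AE v in lborel. AE x in lborel. (s, x, v) \<notin> N"
        by simp
      then show ?case
      proof eventually_elim
        case (elim v)
        from AE_shift [OF elim, of "s *\<^sub>R v"] show ?case
          unfolding F0 by eventually_elim (use True in \<open>simp add: velocity_def\<close>)
      qed
    qed
  next
    case False
    have "AE s in lborel. AE x in lborel. F s x v = 0" for v
      using N1
    proof eventually_elim
      case (elim s)
      from AE_shift [OF elim, of "s *\<^sub>R v"] show ?case
      proof eventually_elim
        case (elim x)
        have "{w. (s, x + s *\<^sub>R v, w) \<in> N} \<in> sets lborel" by measurable
        with elim have "{w. (s, x + s *\<^sub>R v, w) \<in> N} \<in> null_sets lborel"
          by (simp add: AE_iff_null_sets)
        from AE_velocity_notin [OF this False, of v] show ?case
          unfolding F0 by simp
      qed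
    qed
    then have ae: "AE v in lborel. AE s in lborel. (\<integral>\<^sup>+x. F s x v \<partial>lborel) = 0"
      using Fm by (subst nn_integral_0_iff_AE) simp_all
    have "(\<lambda>(z, x). (snd z, x, fst z)) \<in> (borel \<Otimes>\<^sub>M borel) \<Otimes>\<^sub>M borel \<rightarrow>\<^sub>M borel \<Otimes>\<^sub>M borel \<Otimes>\<^sub>M borel"
      by measurable
    from measurable_compose [OF this Fm]
    have [measurable]: "(\<lambda>(z, x). F (snd z) x (fst z)) \<in> borel_measurable ((borel \<Otimes>\<^sub>M borel) \<Otimes>\<^sub>M borel)"
      by (simp add: split_beta')
    have "{z \<in> space (lborel \<Otimes>\<^sub>M lborel). (\<integral>\<^sup>+x. F (snd z) x (fst z) \<partial>lborel) = 0} \<in> sets (lborel \<Otimes>\<^sub>M lborel)"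
      by measurable
    from lborel_pair.AE_commute [of "\<lambda>v s. (\<integral>\<^sup>+x. F s x v \<partial>lborel) = 0", OF this] ae
    have "AE s in lborel. AE v in lborel. (\<integral>\<^sup>+x. F s x v \<partial>lborel) = 0"
      by simp
    then show ?thesis
      using Fm by (subst (asm) nn_integral_0_iff_AE) simp_all
  qed
  from AE_reorder [OF Fm' this] show ?thesis
    unfolding F0 .
qed

section \<open>The weighted norm\<close>

definition weight :: "real \<Rightarrow> real \<Rightarrow> real \<Rightarrow> real \<Rightarrow> R3 \<Rightarrow> R3 \<Rightarrow> real" where
  "weight p q \<alpha> \<beta> x v = jbracket (\<alpha> *\<^sub>R x) powr p * jbracket (\<beta> *\<^sub>R v) powr q"

lemma weight_pos: "weight p q \<alpha> \<beta> x v > 0"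
  using jbracket_ge_1 [of "\<alpha> *\<^sub>R x"] jbracket_ge_1 [of "\<beta> *\<^sub>R v"] by (simp add: weight_def)

lemma measurable_weight [measurable]:
  "(\<lambda>(x, v). weight p q \<alpha> \<beta> x v) \<in> borel_measurable (borel \<Otimes>\<^sub>M borel)"
  unfolding weight_def by measurable

lemma wnorm_weight:
  "wnorm p q \<alpha> \<beta> f = esssup lebesgue (\<lambda>z. ereal (weight p q \<alpha> \<beta> (fst z) (snd z) * \<bar>f (fst z) (snd z)\<bar>))"
  using weight_pos [of p q \<alpha> \<beta>] by (simp add: wnorm_def weight_def split_beta' abs_mult)

lemma measurable_weighted:
  assumes "(\<lambda>(x, v). f x v) \<in> borel_measurable lebesgue"
  shows "(\<lambda>z. ereal (weight p q \<alpha> \<beta> (fst z) (snd z) * \<bar>f (fst z) (snd z)\<bar>)) \<in> borel_measurable lebesgue"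
proof -
  have [measurable]: "(\<lambda>z. f (fst z) (snd z)) \<in> borel_measurable lebesgue"
    using assms by (simp add: split_beta')
  have "(\<lambda>(x, v). weight p q \<alpha> \<beta> x v) \<in> borel_measurable lborel"
    using measurable_weight by (simp add: borel_prod)
  then have [measurable]: "(\<lambda>z. weight p q \<alpha> \<beta> (fst z) (snd z)) \<in> borel_measurable lebesgue"
    by (intro measurable_completion) (simp add: split_beta')
  show ?thesis by measurable
qed

lemma wnorm_le:
  assumes "(\<lambda>(x, v). f x v) \<in> borel_measurable lebesgue"
    and "AE (x, v) in lebesgue. weight p q \<alpha> \<beta> x v * \<bar>f x v\<bar> \<le> c"
  shows "wnorm p q \<alpha> \<beta> f \<le> ereal c"
  unfolding wnorm_weight using assms
  by (intro esssup_I measurable_weighted) (auto simp: split_beta')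

lemma AE_le_wnorm: "AE (x, v) in lebesgue. ereal (weight p q \<alpha> \<beta> x v * \<bar>f x v\<bar>) \<le> wnorm p q \<alpha> \<beta> f"
  unfolding wnorm_weight using esssup_AE by (simp add: split_beta')

lemma wnorm_nonneg: "wnorm p q \<alpha> \<beta> f \<ge> 0"
proof -
  have "(0 :: ereal) = esssup (lebesgue :: (R3 \<times> R3) measure) (\<lambda>_. 0)"
    by (rule esssup_const [symmetric]) simp
  also have "\<dots> \<le> wnorm p q \<alpha> \<beta> f"
    unfolding wnorm_def by (rule esssup_mono) auto
  finally show ?thesis .
qed

lemma wnorm_triangle:
  assumes "f \<in> Xspace p q \<alpha> \<beta>"
  shows "wnorm p q \<alpha> \<beta> f \<le> wnorm p q \<alpha> \<beta> (\<lambda>x v. f x v - g x v) + wnorm p q \<alpha> \<beta> g"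
proof -
  let ?w = "\<lambda>f z. ereal (weight p q \<alpha> \<beta> (fst z) (snd z) * \<bar>f (fst z) (snd z)\<bar>)"
  have "esssup lebesgue (?w f) \<le> esssup lebesgue (\<lambda>z. ?w (\<lambda>x v. f x v - g x v) z + ?w g z)"
  proof (rule esssup_mono)
    show "?w f \<in> borel_measurable lebesgue"
      using assms by (intro measurable_weighted) (simp add: Xspace_def)
    fix z
    have "\<bar>f (fst z) (snd z)\<bar> \<le> \<bar>f (fst z) (snd z) - g (fst z) (snd z)\<bar> + \<bar>g (fst z) (snd z)\<bar>"
      by simp
    from mult_left_mono [OF this, of "weight p q \<alpha> \<beta> (fst z) (snd z)"]
    show "?w f z \<le> ?w (\<lambda>x v. f x v - g x v) z + ?w g z"
      using weight_pos [of p q \<alpha> \<beta> "fst z" "snd z"] by (simp add: distrib_left)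
  qed
  also have "\<dots> \<le> esssup lebesgue (?w (\<lambda>x v. f x v - g x v)) + esssup lebesgue (?w g)"
    by (rule esssup_add)
  finally show ?thesis unfolding wnorm_weight .
qed

text \<open>
  Continuity makes \<open>s \<mapsto> wnorm p q \<alpha> \<beta> (f s)\<close> locally bounded, and the time interval is compact.
\<close>

lemma wnormT_finite:
  assumes f: "f \<in> XTspace p q \<alpha> \<beta> T" and T: "T \<ge> 0"
  obtains N where "N \<ge> 0" and "wnormT p q \<alpha> \<beta> T f = ereal N"
proof -
  have fX: "f t \<in> Xspace p q \<alpha> \<beta>" if "t \<in> {0..T}" for t
    using f that by (auto simp: XTspace_def)
  have "\<exists>d>0. \<forall>t\<in>{0..T}. dist t t0 < d \<longrightarrow> wnorm p q \<alpha> \<beta> (f t) \<le> wnorm p q \<alpha> \<beta> (f t0) + 1"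
    if t0: "t0 \<in> {0..T}" for t0
  proof -
    have "((\<lambda>t. wnorm p q \<alpha> \<beta> (\<lambda>x v. f t x v - f t0 x v)) \<longlongrightarrow> 0) (at t0 within {0..T})"
      using f t0 by (auto simp: XTspace_def)
    from order_tendstoD(2) [OF this, of 1]
    obtain d where d: "d > 0" and
      small: "\<And>t. t \<in> {0..T} \<Longrightarrow> t \<noteq> t0 \<Longrightarrow> dist t t0 < d \<Longrightarrow> wnorm p q \<alpha> \<beta> (\<lambda>x v. f t x v - f t0 x v) < 1"
      by (auto simp: eventually_at)
    have "wnorm p q \<alpha> \<beta> (f t) \<le> wnorm p q \<alpha> \<beta> (f t0) + 1" if "t \<in> {0..T}" "dist t t0 < d" for t
    proof (cases "t = t0")
      case True
      then show ?thesis by (simp add: ereal_le_add_self)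
    next
      case False
      have "wnorm p q \<alpha> \<beta> (f t) \<le> wnorm p q \<alpha> \<beta> (\<lambda>x v. f t x v - f t0 x v) + wnorm p q \<alpha> \<beta> (f t0)"
        by (rule wnorm_triangle [OF fX [OF that(1)]])
      also have "\<dots> \<le> 1 + wnorm p q \<alpha> \<beta> (f t0)"
        using small [OF that(1) False that(2)] by (intro add_right_mono) simp
      finally show ?thesis by (simp add: add.commute)
    qed
    with d show ?thesis by blast
  qed
  then obtain d where d: "\<And>t0. t0 \<in> {0..T} \<Longrightarrow> d t0 > 0"
    "\<And>t0 t. t0 \<in> {0..T} \<Longrightarrow> t \<in> {0..T} \<Longrightarrow> dist t t0 < d t0 \<Longrightarrow>
       wnorm p q \<alpha> \<beta> (f t) \<le> wnorm p q \<alpha> \<beta> (f t0) + 1"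
    by metis
  have "compact {0..T}" by simp
  then obtain D where D: "D \<subseteq> {0..T}" "finite D" "{0..T} \<subseteq> (\<Union>t0\<in>D. ball t0 (d t0))"
    by (rule compactE_image [of _ "{0..T}" "\<lambda>t0. ball t0 (d t0)"]) (use d(1) in \<open>force+\<close>)
  \<comment> \<open>All summands are nonnegative, so the sum over the finite subcover dominates each local bound.\<close>
  define B where "B = (\<Sum>t0\<in>D. wnorm p q \<alpha> \<beta> (f t0) + 1)"
  have fin: "wnorm p q \<alpha> \<beta> (f t) \<noteq> \<infinity>" if "t \<in> {0..T}" for t
    using fX [OF that] by (auto simp: Xspace_def)
  have "B \<noteq> \<infinity>"
    unfolding B_def using fin D by (auto simp: sum_Pinfty)
  have "wnormT p q \<alpha> \<beta> T f \<le> B"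
    unfolding wnormT_def
  proof (rule SUP_least)
    fix t assume t: "t \<in> {0..T}"
    then obtain t0 where t0: "t0 \<in> D" "dist t t0 < d t0"
      using D(3) by (auto simp: dist_commute)
    have "wnorm p q \<alpha> \<beta> (f t) \<le> wnorm p q \<alpha> \<beta> (f t0) + 1"
      using d(2) t0 t D(1) by blast
    also have "\<dots> \<le> B"
      unfolding B_def sum.remove [OF D(2) t0(1)]
      by (intro ereal_le_add_self sum_nonneg) (simp add: wnorm_nonneg)
    finally show "wnorm p q \<alpha> \<beta> (f t) \<le> B" .
  qed
  moreover have "0 \<le> wnormT p q \<alpha> \<beta> T f"
    unfolding wnormT_def by (rule SUP_upper2 [of 0]) (use T wnorm_nonneg in auto)
  ultimately show ?thesis
    using that \<open>B \<noteq> \<infinity>\<close> by (cases "wnormT p q \<alpha> \<beta> T f") auto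
qed

lemma AE_le_wnormT:
  assumes N: "wnormT p q \<alpha> \<beta> T f = ereal N" and s: "s \<in> {0..T}"
  shows "AE (x, v) in lebesgue. weight p q \<alpha> \<beta> x v * \<bar>f s x v\<bar> \<le> N"
proof -
  have "wnorm p q \<alpha> \<beta> (f s) \<le> ereal N"
    unfolding N [symmetric] wnormT_def by (rule SUP_upper [OF s])
  moreover have "AE (x, v) in lebesgue. ereal (weight p q \<alpha> \<beta> x v * \<bar>f s x v\<bar>) \<le> wnorm p q \<alpha> \<beta> (f s)"
    by (rule AE_le_wnorm)
  ultimately show ?thesis
    by (auto elim!: eventually_mono dest: order_trans)
qed

section \<open>Borel representatives\<close>

lemma AE_shear:
  assumes "AE (x, v) in lborel. P x v"
  shows "AE (x, v) in lborel. P (x + a *\<^sub>R v) (v :: R3)"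
proof -
  obtain N where N: "N \<in> null_sets lborel" "{z. \<not> (case z of (x, v) \<Rightarrow> P x v)} \<subseteq> N"
    using assms by (auto simp: eventually_ae_filter)
  have [measurable]: "N \<in> sets (borel \<Otimes>\<^sub>M borel)"
    unfolding borel_prod using null_setsD2 [OF N(1)] by simp
  have sw: "(AE x in lborel. AE v in lborel. (x + c *\<^sub>R v, v) \<notin> N) \<longleftrightarrow>
      (AE v in lborel. AE x in lborel. (x + c *\<^sub>R v, v) \<notin> N)" for c
    by (rule lborel_pair.AE_commute) measurable
  have "AE x in lborel. AE v in lborel. (x, v) \<notin> N"
    by (rule lborel_pair.AE_pair) (unfold lborel_prod, rule AE_not_in [OF N(1)])
  then have "AE v in lborel. AE x in lborel. (x, v) \<notin> N"
    using sw [of 0] by simp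
  then have "AE v in lborel. AE x in lborel. (x + a *\<^sub>R v, v) \<notin> N"
    by eventually_elim (rule AE_shift)
  then have ae: "AE x in lborel. AE v in lborel. (x + a *\<^sub>R v, v) \<notin> N"
    using sw by simp
  have "AE z in lborel \<Otimes>\<^sub>M lborel. (fst z + a *\<^sub>R snd z, snd z) \<notin> N"
    by (rule lborel_pair.AE_pair_measure) (measurable, use ae in simp)
  then show ?thesis
    unfolding lborel_prod by eventually_elim (use N(2) in auto)
qed

text \<open>
  The norm bounds \<open>g\<close> along characteristics only for almost every \<open>(x, v)\<close> at each time.  By Fubini the
  exceptional sets of all times in \<open>{0..T}\<close> form one null set of \<open>(s, y, w)\<close>.  A Borel version of \<open>g\<close> is
  set to \<open>0\<close> wherever it violates the bound; on \<open>{0..T}\<close> this changes it only on a null set, and the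
  result satisfies the bound everywhere, so that pointwise estimates apply to it.
\<close>

lemma Borel_representative:
  fixes g :: "real \<Rightarrow> R3 \<Rightarrow> R3 \<Rightarrow> real"
  assumes meas: "(\<lambda>(s, x, v). g s x v) \<in> borel_measurable (lebesgue_on ({0..T} \<times> UNIV))"
    and N: "N \<ge> 0"
    and bound: "\<And>s. s \<in> {0..T} \<Longrightarrow>
      AE (x, v) in lebesgue. weight p q \<alpha> \<beta> x v * \<bar>transport (- s) (g s) x v\<bar> \<le> N"
  obtains g' :: "real \<times> R3 \<times> R3 \<Rightarrow> real"
  where "g' \<in> borel_measurable borel"
    and "\<And>s y w. weight p q \<alpha> \<beta> (y - s *\<^sub>R w) w * \<bar>g' (s, y, w)\<bar> \<le> N"
    and "AE (s, y, w) in lborel. s \<in> {0..T} \<longrightarrow> g s y w = g' (s, y, w)"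
proof -
  define g0 where "g0 = (\<lambda>z. if z \<in> {0..T} \<times> UNIV then (case z of (s, x, v) \<Rightarrow> g s x v) else 0)"
  have "closed ({0..T} \<times> (UNIV :: (R3 \<times> R3) set))"
    by (intro closed_Times) auto
  then have "{0..T} \<times> (UNIV :: (R3 \<times> R3) set) \<in> sets lebesgue"
    by (intro sets_completionI_sets) simp
  then have "g0 \<in> borel_measurable lebesgue"
    unfolding g0_def using meas by (subst borel_measurable_if) auto
  then obtain g1 where g1: "g1 \<in> borel_measurable lborel" "AE z in lborel. g0 z = g1 z"
    using completion_ex_borel_measurable_real by blast
  have [measurable]: "g1 \<in> borel_measurable (borel \<Otimes>\<^sub>M borel \<Otimes>\<^sub>M borel)"
    using g1(1) unfolding borel_prod by simp
  define B where "B = {(s, y, w). weight p q \<alpha> \<beta> (y - s *\<^sub>R w) w * \<bar>g1 (s, y, w)\<bar> \<le> N}"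
  have "{z \<in> space (borel \<Otimes>\<^sub>M borel \<Otimes>\<^sub>M borel).
      weight p q \<alpha> \<beta> (fst (snd z) - fst z *\<^sub>R snd (snd z)) (snd (snd z)) * \<bar>g1 z\<bar> \<le> N}
      \<in> sets (borel \<Otimes>\<^sub>M borel \<Otimes>\<^sub>M borel)"
    by measurable
  then have B [measurable]: "B \<in> sets (borel \<Otimes>\<^sub>M borel \<Otimes>\<^sub>M borel)"
    by (simp add: B_def split_beta' space_pair_measure)
  have "AE s in lborel. AE yw in lborel. g0 (s, yw) = g1 (s, yw)"
    by (rule lborel_pair.AE_pair) (unfold lborel_prod, rule g1(2))
  then have "AE s in lborel. AE yw in lborel. s \<in> {0..T} \<longrightarrow> (s, yw) \<in> B"
  proof eventually_elim
    case (elim s)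
    show ?case
    proof (cases "s \<in> {0..T}")
      case True
      have "AE (x, v) in lborel. weight p q \<alpha> \<beta> x v * \<bar>g s (x + s *\<^sub>R v) v\<bar> \<le> N"
        using bound [OF True] by (simp add: AE_completion_iff transport_def)
      from AE_shear [OF this, of "- s"] elim show ?thesis
      proof eventually_elim
        case (elim yw)
        then show ?case
          using True by (cases yw) (simp add: B_def g0_def)
      qed
    next
      case False
      then show ?thesis by (simp only: simp_thms eventually_True)
    qed
  qed
  moreover have "B \<in> sets (borel \<Otimes>\<^sub>M borel)"
    using B unfolding borel_prod .
  then have "{z \<in> space (lborel \<Otimes>\<^sub>M lborel). fst z \<in> {0..T} \<longrightarrow> z \<in> B} \<in> sets (lborel \<Otimes>\<^sub>M lborel)"
    by measurable
  ultimately have "AE z in lborel \<Otimes>\<^sub>M lborel. fst z \<in> {0..T} \<longrightarrow> z \<in> B"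
    by (intro lborel_pair.AE_pair_measure) simp_all
  then have ae: "AE z in lborel. fst z \<in> {0..T} \<longrightarrow> z \<in> B"
    unfolding lborel_prod .
  show thesis
  proof
    show "(\<lambda>z. if z \<in> B then g1 z else 0) \<in> borel_measurable borel"
      unfolding borel_prod [symmetric] by measurable
    show "weight p q \<alpha> \<beta> (y - s *\<^sub>R w) w * \<bar>if (s, y, w) \<in> B then g1 (s, y, w) else 0\<bar> \<le> N" for s y w
      using N by (auto simp: B_def)
    show "AE (s, y, w) in lborel. s \<in> {0..T} \<longrightarrow> g s y w = (if (s, y, w) \<in> B then g1 (s, y, w) else 0)"
      using ae g1(2)
    proof eventually_elim
      case (elim z)
      then show ?case by (cases z) (auto simp: g0_def)
    qed
  qed
qed

section \<open>The pointwise estimate\<close>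

text \<open>
  The indices on the right are those other than \<open>j\<close>, in increasing order.  If \<open>j\<close> is \<open>2\<close> or \<open>3\<close>,
  both \<open>A 0\<close> and \<open>A 1\<close> occur; otherwise one of them does and \<open>A 2 * A 3\<close> replaces the other.
\<close>

lemma three_factors_ge:
  fixes A :: "nat \<Rightarrow> real" and j :: nat
  assumes "\<And>i. A i \<ge> 1" and "A 0 \<le> A 2 * A 3" and "A 1 \<le> A 2 * A 3" and "j \<in> {0, 1, 2, 3}"
  shows "A 0 * A 1 \<le> A (if j = 0 then 1 else 0) * A (if j \<le> 1 then 2 else 1) * A (if j \<le> 2 then 3 else 2)"
proof -
  have pos: "A i \<ge> 0" for i using assms(1) [of i] by simp
  have "A 0 * A 1 \<le> A 1 * (A 2 * A 3)" "A 0 * A 1 \<le> A 0 * (A 2 * A 3)"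
    using mult_right_mono [OF assms(2) pos [of 1]] mult_left_mono [OF assms(3) pos [of 0]]
    by (simp_all add: mult_ac)
  moreover have "A 0 * A 1 \<le> A 0 * A 1 * A i" for i
    using mult_left_mono [OF assms(1) [of i], of "A 0 * A 1"] pos by simp
  from this [of 2] this [of 3] have "A 0 * A 1 \<le> A 0 * A 1 * A 2" "A 0 * A 1 \<le> A 0 * A 1 * A 3" .
  ultimately show ?thesis
    using assms(4) by (auto simp: mult_ac)
qed

text \<open>
  Whatever the three arguments of \<open>L\<^sub>j\<close>, their weights leave the full weight at \<open>(x, v)\<close>, needed for the
  norm of the result, and a full weight for \<open>v\<^sub>1\<close>, needed to integrate over \<open>s\<close> and \<open>v\<^sub>1\<close>.
\<close>

lemma weights_ge:
  fixes p q \<alpha> \<beta> s :: real and x v v\<^sub>1 \<sigma> :: R3 and j :: nat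
  assumes \<sigma>: "norm \<sigma> = 1" and j: "j \<in> {0, 1, 2, 3}" and pq: "p \<ge> 0" "q \<ge> 0"
  defines "W \<equiv> \<lambda>i. weight p q \<alpha> \<beta> (x + s *\<^sub>R (v - velocity i v (v\<^sub>1, \<sigma>))) (velocity i v (v\<^sub>1, \<sigma>))"
  shows "weight p q \<alpha> \<beta> x v * weight p q \<alpha> \<beta> (x + s *\<^sub>R (v - v\<^sub>1)) v\<^sub>1
    \<le> W (if j = 0 then 1 else 0) * W (if j \<le> 1 then 2 else 1) * W (if j \<le> 2 then 3 else 2)"
proof -
  define A where "A i = jbracket (\<alpha> *\<^sub>R (x + s *\<^sub>R (v - velocity i v (v\<^sub>1, \<sigma>))))" for i
  define B where "B i = jbracket (\<beta> *\<^sub>R velocity i v (v\<^sub>1, \<sigma>))" for i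
  have A1: "A i \<ge> 1" and B1: "B i \<ge> 1" for i
    by (simp_all add: A_def B_def jbracket_ge_1)
  have A': "A i = jbracket (\<alpha> *\<^sub>R (x + s *\<^sub>R v) + (- \<alpha> * s) *\<^sub>R velocity i v (v\<^sub>1, \<sigma>))" for i
    by (simp add: A_def algebra_simps)
  have B': "B i = jbracket (0 + \<beta> *\<^sub>R velocity i v (v\<^sub>1, \<sigma>))" for i
    by (simp add: B_def)
  have A23: "A 0 \<le> A 2 * A 3" "A 1 \<le> A 2 * A 3"
    unfolding A' by (rule jbracket_mult_ge [OF collision_energy [OF \<sigma>]])+
  have B23: "B 0 \<le> B 2 * B 3" "B 1 \<le> B 2 * B 3"
    unfolding B' by (rule jbracket_mult_ge [OF collision_energy [OF \<sigma>]])+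
  have W: "W i = A i powr p * B i powr q" for i
    by (simp add: W_def A_def B_def weight_def)
  have pos: "A i \<ge> 0" "B i \<ge> 0" for i
    using A1 [of i] B1 [of i] by auto
  have "weight p q \<alpha> \<beta> x v * weight p q \<alpha> \<beta> (x + s *\<^sub>R (v - v\<^sub>1)) v\<^sub>1 = W 0 * W 1"
    by (simp add: W_def velocity_def)
  also have "\<dots> = (A 0 * A 1) powr p * (B 0 * B 1) powr q"
    using pos by (simp add: W powr_mult)
  also have "\<dots> \<le> (A (if j = 0 then 1 else 0) * A (if j \<le> 1 then 2 else 1) * A (if j \<le> 2 then 3 else 2)) powr p
      * (B (if j = 0 then 1 else 0) * B (if j \<le> 1 then 2 else 1) * B (if j \<le> 2 then 3 else 2)) powr q"
    by (rule mult_mono [OF powr_mono2 [OF pq(1) _ three_factors_ge [OF A1 A23 j]]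
          powr_mono2 [OF pq(2) _ three_factors_ge [OF B1 B23 j]]]) (simp_all add: pos)
  also have "\<dots> = W (if j = 0 then 1 else 0) * W (if j \<le> 1 then 2 else 1) * W (if j \<le> 2 then 3 else 2)"
    using pos unfolding W by (simp only: powr_mult mult_nonneg_nonneg) (simp only: mult_ac)
  finally show ?thesis .
qed

text \<open>
  The integrand of \<open>L\<^sub>j(g, h, l)\<close> at the point \<open>(x + s v, v)\<close> of the characteristic; the index of each velocity
  depends on \<open>j\<close> as in \<open>three_factors_ge\<close>.
\<close>

definition collision_integrand ::
    "nat \<Rightarrow> (real \<times> R3 \<times> R3 \<Rightarrow> real) \<Rightarrow> (real \<times> R3 \<times> R3 \<Rightarrow> real) \<Rightarrow> (real \<times> R3 \<times> R3 \<Rightarrow> real)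
      \<Rightarrow> R3 \<times> R3 \<Rightarrow> real \<Rightarrow> R3 \<times> R3 \<Rightarrow> real" where
  "collision_integrand j g h l = (\<lambda>(x, v) s z. norm (v - fst z)
     * (g (s, x + s *\<^sub>R v, velocity (if j = 0 then 1 else 0) v z)
      * h (s, x + s *\<^sub>R v, velocity (if j \<le> 1 then 2 else 1) v z)
      * l (s, x + s *\<^sub>R v, velocity (if j \<le> 2 then 3 else 2) v z)))"

lemma transport_delta_integrand:
  assumes "j \<in> {0, 1, 2, 3}"
  shows "delta_integrand (L_density j (g s (x + s *\<^sub>R v)) (h s (x + s *\<^sub>R v)) (l s (x + s *\<^sub>R v))) v z
    = collision_integrand j (\<lambda>(s, x, v). g s x v) (\<lambda>(s, x, v). h s x v) (\<lambda>(s, x, v). l s x v) (x, v) s z"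
  using assms
  by (cases z) (auto simp: delta_integrand_def L_density_def collision_integrand_def velocity_def outgoing_def)

text \<open>
  At the point \<open>(y, w)\<close> and time \<open>s\<close> the bound on \<open>g\<close> carries the weight of the foot \<open>y - s w\<close> of the
  characteristic; for \<open>y = x + s v\<close> this foot is \<open>x + s (v - w)\<close>.
\<close>

lemma collision_integrand_bound:
  assumes pq: "p \<ge> 0" "q \<ge> 0" and j: "j \<in> {0, 1, 2, 3}" and z: "norm (snd z) = 1"
    and N: "Ng \<ge> 0" "Nh \<ge> 0" "Nl \<ge> 0"
    and g: "\<And>s y w. weight p q \<alpha> \<beta> (y - s *\<^sub>R w) w * \<bar>g (s, y, w)\<bar> \<le> Ng"
    and h: "\<And>s y w. weight p q \<alpha> \<beta> (y - s *\<^sub>R w) w * \<bar>h (s, y, w)\<bar> \<le> Nh"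
    and l: "\<And>s y w. weight p q \<alpha> \<beta> (y - s *\<^sub>R w) w * \<bar>l (s, y, w)\<bar> \<le> Nl"
  shows "\<bar>collision_integrand j g h l (x, v) s z\<bar> \<le> Ng * Nh * Nl / weight p q \<alpha> \<beta> x v
    * (norm (v - fst z) * jbracket (\<alpha> *\<^sub>R (x + s *\<^sub>R (v - fst z))) powr (- p) * jbracket (\<beta> *\<^sub>R fst z) powr (- q))"
proof -
  define W where "W i = weight p q \<alpha> \<beta> (x + s *\<^sub>R (v - velocity i v z)) (velocity i v z)" for i
  define W0 where "W0 = weight p q \<alpha> \<beta> x v"
  define W1 where "W1 = weight p q \<alpha> \<beta> (x + s *\<^sub>R (v - fst z)) (fst z)"
  let ?a = "if j = 0 then 1 else 0 :: nat" and ?b = "if j \<le> 1 then 2 else 1 :: nat"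
    and ?c = "if j \<le> 2 then 3 else 2 :: nat"
  let ?G = "\<lambda>f i. \<bar>f (s, x + s *\<^sub>R v, velocity i v z) :: real\<bar>"
  have pos: "W i > 0" "W0 > 0" "W1 > 0" for i
    by (simp_all add: W_def W0_def W1_def weight_pos)
  have shift: "x + s *\<^sub>R v - s *\<^sub>R w = x + s *\<^sub>R (v - w)" for w
    by (simp add: algebra_simps)
  have ghl: "W i * ?G g i \<le> Ng" "W i * ?G h i \<le> Nh" "W i * ?G l i \<le> Nl" for i
    unfolding W_def using g [of "x + s *\<^sub>R v" s "velocity i v z"] h [of "x + s *\<^sub>R v" s "velocity i v z"]
      l [of "x + s *\<^sub>R v" s "velocity i v z"] unfolding shift by simp_all
  have "(W0 * W1) * (?G g ?a * ?G h ?b * ?G l ?c) \<le> (W ?a * W ?b * W ?c) * (?G g ?a * ?G h ?b * ?G l ?c)"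
    using weights_ge [OF z j pq, where \<alpha> = \<alpha> and \<beta> = \<beta> and x = x and v = v and v\<^sub>1 = "fst z" and s = s]
    by (intro mult_right_mono) (simp_all add: W_def W0_def W1_def)
  also have "\<dots> = (W ?a * ?G g ?a) * (W ?b * ?G h ?b) * (W ?c * ?G l ?c)"
    by (simp only: mult_ac)
  also have "\<dots> \<le> Ng * Nh * Nl"
    using pos N by (intro mult_mono ghl mult_nonneg_nonneg) (simp_all add: less_imp_le)
  finally have "?G g ?a * ?G h ?b * ?G l ?c \<le> Ng * Nh * Nl / W0 * (1 / W1)"
    using pos by (simp add: field_simps)
  then have "norm (v - fst z) * (?G g ?a * ?G h ?b * ?G l ?c) \<le> norm (v - fst z) * (Ng * Nh * Nl / W0 * (1 / W1))"
    by (intro mult_left_mono) simp_all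
  also have "1 / W1 = jbracket (\<alpha> *\<^sub>R (x + s *\<^sub>R (v - fst z))) powr (- p) * jbracket (\<beta> *\<^sub>R fst z) powr (- q)"
    by (simp add: W1_def weight_def powr_minus divide_inverse)
  finally show ?thesis
    by (simp add: collision_integrand_def abs_mult W0_def mult_ac)
qed

lemma measurable_collision_integrand [measurable]:
  assumes "g \<in> borel_measurable borel" "h \<in> borel_measurable borel" "l \<in> borel_measurable borel"
  shows "(\<lambda>(z, s, y). collision_integrand j g h l z s y)
    \<in> borel_measurable ((borel \<Otimes>\<^sub>M borel) \<Otimes>\<^sub>M borel \<Otimes>\<^sub>M borel \<Otimes>\<^sub>M borel)"
proof -
  have [measurable]: "g \<in> borel_measurable (borel \<Otimes>\<^sub>M borel \<Otimes>\<^sub>M borel)"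
    "h \<in> borel_measurable (borel \<Otimes>\<^sub>M borel \<Otimes>\<^sub>M borel)"
    "l \<in> borel_measurable (borel \<Otimes>\<^sub>M borel \<Otimes>\<^sub>M borel)"
    unfolding borel_prod by fact+
  show ?thesis
    unfolding collision_integrand_def split_beta' by measurable
qed

text \<open>
  The time integral has to be done before the integral over \<open>v\<^sub>1\<close>, since its bound is uniform in \<open>v - v\<^sub>1\<close>.
\<close>

lemma dominating_integral:
  assumes "p > 1" "q > 3" "\<alpha> > 0" "\<beta> > 0"
  shows "(\<integral>\<^sup>+s. \<integral>\<^sup>+z. ennreal (norm (v - fst z) * jbracket (\<alpha> *\<^sub>R (x + s *\<^sub>R (v - fst z))) powr (- p)
      * jbracket (\<beta> *\<^sub>R fst z) powr (- q)) \<partial>outgoing_measure \<partial>lborel)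
    \<le> ennreal (2 * p / (\<alpha> * (p - 1)) * (4 * pi * (4 * pi / \<beta> ^ 3 * (1 / 3 + 1 / (q - 3)))))"
proof -
  let ?f = "\<lambda>s w. norm (v - w) * jbracket (\<alpha> *\<^sub>R (x + s *\<^sub>R (v - w))) powr (- p)"
  let ?k = "\<lambda>w. jbracket (\<beta> *\<^sub>R w) powr (- q)"
  let ?C = "2 * p / (\<alpha> * (p - 1))" and ?D = "4 * pi / \<beta> ^ 3 * (1 / 3 + 1 / (q - 3))"
  have "(\<integral>\<^sup>+s. \<integral>\<^sup>+z. ennreal (?f s (fst z) * ?k (fst z)) \<partial>outgoing_measure \<partial>lborel)
      = (\<integral>\<^sup>+s. \<integral>\<^sup>+w. ennreal (?f s w * ?k w) * ennreal (4 * pi) \<partial>lborel \<partial>lborel)"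
    by (subst sphere.nn_integral_fst [symmetric]) (simp_all add: emeasure_sphere_measure_UNIV)
  also have "\<dots> = (\<integral>\<^sup>+w. \<integral>\<^sup>+s. ennreal (?f s w * ?k w) * ennreal (4 * pi) \<partial>lborel \<partial>lborel)"
    by (rule lborel_pair.Fubini') measurable
  also have "\<dots> = (\<integral>\<^sup>+w. (\<integral>\<^sup>+s. ennreal (?f s w) \<partial>lborel) * (ennreal (?k w) * ennreal (4 * pi)) \<partial>lborel)"
    by (subst nn_integral_multc [symmetric]) (simp_all add: ennreal_mult mult.assoc)
  also have "\<dots> \<le> (\<integral>\<^sup>+w. ennreal ?C * (ennreal (?k w) * ennreal (4 * pi)) \<partial>lborel)"
    by (intro nn_integral_mono mult_right_mono time_decay_integral assms) simp
  also have "\<dots> = ennreal ?C * ((\<integral>\<^sup>+w. ennreal (?k w) \<partial>lborel) * ennreal (4 * pi))"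
    by (simp add: nn_integral_cmult nn_integral_multc)
  also have "\<dots> \<le> ennreal ?C * (ennreal ?D * ennreal (4 * pi))"
    by (intro mult_left_mono mult_right_mono velocity_decay_integral assms) simp_all
  also have "\<dots> = ennreal (?C * (4 * pi * ?D))"
    using assms by (simp add: ennreal_mult [symmetric] mult_ac)
  finally show ?thesis .
qed

section \<open>Integration along characteristics\<close>

text \<open>
  The integrals of the theorem are taken over completed measures, where measurability passes to every
  function that agrees almost everywhere with a measurable one.
\<close>

lemma completion_AE_eq:
  fixes f g :: "'a \<Rightarrow> real"
  assumes g [measurable]: "g \<in> borel_measurable M" and ae: "AE x in M. f x = g x"
  shows "integrable (completion M) f \<longleftrightarrow> integrable M g"
    and "integral\<^sup>L (completion M) f = integral\<^sup>L M g"
proof -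
  have ae': "AE x in completion M. f x = g x"
    using ae by (rule AE_completion)
  have g': "g \<in> borel_measurable (completion M)"
    by (rule measurable_completion) (rule g)
  have f': "f \<in> borel_measurable (completion M)"
  proof (rule measurableI)
    fix A :: "real set" assume A: "A \<in> sets borel"
    show "f -` A \<inter> space (completion M) \<in> sets (completion M)"
    proof (rule completion.in_sets_AE)
      show "AE x in completion M. x \<in> g -` A \<inter> space (completion M) \<longleftrightarrow> x \<in> f -` A \<inter> space (completion M)"
        using ae' by eventually_elim simp
    qed (use measurable_sets [OF g' A] in auto)
  qed simp
  show "integrable (completion M) f \<longleftrightarrow> integrable M g"
    using integrable_cong_AE [OF f' g' ae'] by (simp add: integrable_completion)
  show "integral\<^sup>L (completion M) f = integral\<^sup>L M g"
    using integral_cong_AE [OF f' g' ae'] by (simp add: integral_completion)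
qed

text \<open>
  Replacing the functions by representatives changes the collision integrand only on null sets, because
  all its arguments avoid a null set almost everywhere.
\<close>

lemma AE_representative_integrand:
  fixes T :: real
  assumes j: "j \<in> {0, 1, 2, 3}"
    and g: "AE (s, y, w) in lborel. s \<in> {0..T} \<longrightarrow> g s y w = g' (s, y, w)"
    and h: "AE (s, y, w) in lborel. s \<in> {0..T} \<longrightarrow> h s y w = h' (s, y, w)"
    and l: "AE (s, y, w) in lborel. s \<in> {0..T} \<longrightarrow> l s y w = l' (s, y, w)"
  shows "AE (x, v) in lborel. AE s in lborel. s \<in> {0..T} \<longrightarrow> (AE z in outgoing_measure.
    delta_integrand (L_density j (g s (x + s *\<^sub>R v)) (h s (x + s *\<^sub>R v)) (l s (x + s *\<^sub>R v))) v z
      = collision_integrand j g' h' l' (x, v) s z)"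
proof -
  have "AE (s, y, w) in lborel. s \<in> {0..T} \<longrightarrow>
      g s y w = g' (s, y, w) \<and> h s y w = h' (s, y, w) \<and> l s y w = l' (s, y, w)"
    using g h l by eventually_elim auto
  then obtain N where N: "N \<in> null_sets lborel" and
    sub: "{z \<in> space lborel. \<not> (case z of (s, y, w) \<Rightarrow> s \<in> {0..T} \<longrightarrow>
      g s y w = g' (s, y, w) \<and> h s y w = h' (s, y, w) \<and> l s y w = l' (s, y, w))} \<subseteq> N"
    unfolding eventually_ae_filter by blast
  have eq: "g s y w = g' (s, y, w) \<and> h s y w = h' (s, y, w) \<and> l s y w = l' (s, y, w)"
    if "(s, y, w) \<notin> N" "s \<in> {0..T}" for s y w
    using subsetD [OF sub, of "(s, y, w)"] that by auto
  have av: "AE xv in lborel. AE s in lborel. AE z in outgoing_measure.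
      (s, fst xv + s *\<^sub>R snd xv, velocity i (snd xv) z) \<notin> N" for i
    using AE_transported_velocity_notin [OF N, of i] by (simp add: split_beta')
  from av [of 0] av [of 1] av [of 2] av [of 3] show ?thesis
  proof eventually_elim
    case (elim xv)
    obtain x v where xv: "xv = (x, v)" by (cases xv)
    from elim have "AE s in lborel. s \<in> {0..T} \<longrightarrow> (AE z in outgoing_measure.
        delta_integrand (L_density j (g s (x + s *\<^sub>R v)) (h s (x + s *\<^sub>R v)) (l s (x + s *\<^sub>R v))) v z
          = collision_integrand j g' h' l' (x, v) s z)"
    proof eventually_elim
      case (elim s)
      show ?case
      proof
        assume s: "s \<in> {0..T}"
        from elim show "AE z in outgoing_measure.
            delta_integrand (L_density j (g s (x + s *\<^sub>R v)) (h s (x + s *\<^sub>R v)) (l s (x + s *\<^sub>R v))) v z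
              = collision_integrand j g' h' l' (x, v) s z"
        proof eventually_elim
          case (elim z)
          show ?case
            unfolding transport_delta_integrand [OF j]
            using elim eq s by (auto simp: collision_integrand_def xv)
        qed
      qed
    qed
    then show ?case by (simp add: xv)
  qed
qed

text \<open>
  The dominating function is integrable jointly in \<open>(s, v\<^sub>1, \<sigma>)\<close>, for every \<open>(x, v)\<close>.  Fubini then gives
  the convergence of the collision integral for almost every \<open>s\<close>, its integrability in \<open>s\<close>, and the bound.
\<close>

lemma collision_integrand_integrable:
  fixes p q \<alpha> \<beta> t :: real and x v :: R3 and j :: nat
  assumes pq: "p > 1" "q > 3" and ab: "\<alpha> > 0" "\<beta> > 0" and j: "j \<in> {0, 1, 2, 3}"
    and N: "Ng \<ge> 0" "Nh \<ge> 0" "Nl \<ge> 0"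
    and meas: "g \<in> borel_measurable borel" "h \<in> borel_measurable borel" "l \<in> borel_measurable borel"
    and g: "\<And>s y w. weight p q \<alpha> \<beta> (y - s *\<^sub>R w) w * \<bar>g (s, y, w)\<bar> \<le> Ng"
    and h: "\<And>s y w. weight p q \<alpha> \<beta> (y - s *\<^sub>R w) w * \<bar>h (s, y, w)\<bar> \<le> Nh"
    and l: "\<And>s y w. weight p q \<alpha> \<beta> (y - s *\<^sub>R w) w * \<bar>l (s, y, w)\<bar> \<le> Nl"
  defines "\<Phi> \<equiv> collision_integrand j g h l (x, v)"
    and "D \<equiv> 2 * p / (\<alpha> * (p - 1)) * (4 * pi * (4 * pi / \<beta> ^ 3 * (1 / 3 + 1 / (q - 3))))"
  shows "AE s in lborel. s \<in> {0..t} \<longrightarrow> integrable outgoing_measure (\<Phi> s)"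
    and "set_integrable lborel {0..t} (\<lambda>s. LINT z|outgoing_measure. \<Phi> s z)"
    and "weight p q \<alpha> \<beta> x v * \<bar>LINT s:{0..t}|lborel. LINT z|outgoing_measure. \<Phi> s z\<bar>
      \<le> Ng * Nh * Nl * D"
proof -
  interpret P: pair_sigma_finite "lborel :: real measure" "outgoing_measure" ..
  define c where "c = Ng * Nh * Nl / weight p q \<alpha> \<beta> x v"
  define k where "k s z = norm (v - fst z) * jbracket (\<alpha> *\<^sub>R (x + s *\<^sub>R (v - fst z))) powr (- p)
    * jbracket (\<beta> *\<^sub>R fst z) powr (- q)" for s and z :: "R3 \<times> R3"
  define f where "f = (\<lambda>(s, z). indicator {0..t} s * \<Phi> s z)"
  have c: "c \<ge> 0"
    unfolding c_def using N weight_pos [of p q \<alpha> \<beta> x v] by simp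
  have D: "D \<ge> 0"
    unfolding D_def using pq ab by simp
  have [measurable]: "(\<lambda>(s, z). \<Phi> s z) \<in> borel_measurable (lborel \<Otimes>\<^sub>M outgoing_measure)"
  proof -
    have "(\<lambda>y. ((x, v), y)) \<in> lborel \<Otimes>\<^sub>M outgoing_measure \<rightarrow>\<^sub>M (borel \<Otimes>\<^sub>M borel) \<Otimes>\<^sub>M borel \<Otimes>\<^sub>M borel \<Otimes>\<^sub>M borel"
      by measurable
    from measurable_compose [OF this measurable_collision_integrand [OF meas, of j]] show ?thesis
      by (simp add: \<Phi>_def split_beta')
  qed
  have fm [measurable]: "f \<in> borel_measurable (lborel \<Otimes>\<^sub>M outgoing_measure)"
    unfolding f_def by measurable
  have km [measurable]: "(\<lambda>(s, z). k s z) \<in> borel_measurable (lborel \<Otimes>\<^sub>M outgoing_measure)"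
    unfolding k_def by measurable
  have fk: "AE z in outgoing_measure. norm (f (s, z)) \<le> c * k s z" for s
    using AE_outgoing_measure_sphere
  proof eventually_elim
    case (elim z)
    have "\<bar>\<Phi> s z\<bar> \<le> c * k s z"
      unfolding \<Phi>_def c_def k_def
      using pq by (intro collision_integrand_bound j elim N g h l) auto
    moreover have "norm (f (s, z)) \<le> \<bar>\<Phi> s z\<bar>"
      by (simp add: f_def indicator_def)
    ultimately show ?case by simp
  qed
  have "(\<integral>\<^sup>+y. norm (f y) \<partial>(lborel \<Otimes>\<^sub>M outgoing_measure))
      = (\<integral>\<^sup>+s. \<integral>\<^sup>+z. norm (f (s, z)) \<partial>outgoing_measure \<partial>lborel)"
    by (rule sigma_finite_measure.nn_integral_fst [OF sigma_finite_outgoing_measure, symmetric]) measurable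
  also have "\<dots> \<le> (\<integral>\<^sup>+s. \<integral>\<^sup>+z. ennreal (c * k s z) \<partial>outgoing_measure \<partial>lborel)"
  proof (rule nn_integral_mono, rule nn_integral_mono_AE)
    fix s
    show "AE z in outgoing_measure. ennreal (norm (f (s, z))) \<le> ennreal (c * k s z)"
      using fk [of s] by eventually_elim (rule ennreal_leI)
  qed
  also have "\<dots> = ennreal c * (\<integral>\<^sup>+s. \<integral>\<^sup>+z. ennreal (k s z) \<partial>outgoing_measure \<partial>lborel)"
    using c by (simp add: ennreal_mult' nn_integral_cmult)
  also have "\<dots> \<le> ennreal c * ennreal D"
    unfolding k_def D_def by (intro mult_left_mono dominating_integral pq ab) simp
  also have "\<dots> = ennreal (c * D)"
    using c D by (simp add: ennreal_mult)
  finally have bound: "(\<integral>\<^sup>+y. norm (f y) \<partial>(lborel \<Otimes>\<^sub>M outgoing_measure)) \<le> ennreal (c * D)" .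
  have int: "integrable (lborel \<Otimes>\<^sub>M outgoing_measure) f"
    by (rule integrableI_bounded [OF fm]) (use bound in \<open>auto intro: le_less_trans\<close>)
  have "AE s in lborel. integrable outgoing_measure (\<lambda>z. f (s, z))"
    by (rule P.AE_integrable_fst' [OF int])
  then show "AE s in lborel. s \<in> {0..t} \<longrightarrow> integrable outgoing_measure (\<Phi> s)"
    by eventually_elim (auto simp: f_def)
  have slice: "(LINT z|outgoing_measure. f (s, z))
      = indicator {0..t} s *\<^sub>R (LINT z|outgoing_measure. \<Phi> s z)" for s
    by (simp add: f_def)
  show "set_integrable lborel {0..t} (\<lambda>s. LINT z|outgoing_measure. \<Phi> s z)"
    using P.integrable_fst' [OF int] unfolding slice set_integrable_def .
  have "(LINT s:{0..t}|lborel. LINT z|outgoing_measure. \<Phi> s z)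
      = integral\<^sup>L (lborel \<Otimes>\<^sub>M outgoing_measure) f"
    using P.integral_fst' [OF int] unfolding slice set_lebesgue_integral_def .
  moreover have "ennreal (norm (integral\<^sup>L (lborel \<Otimes>\<^sub>M outgoing_measure) f)) \<le> ennreal (c * D)"
    using integral_norm_bound_ennreal [OF int] bound by (rule order_trans)
  ultimately have "\<bar>LINT s:{0..t}|lborel. LINT z|outgoing_measure. \<Phi> s z\<bar> \<le> c * D"
    using c D by (simp add: ennreal_le_iff)
  then have "weight p q \<alpha> \<beta> x v * \<bar>LINT s:{0..t}|lborel. LINT z|outgoing_measure. \<Phi> s z\<bar>
      \<le> weight p q \<alpha> \<beta> x v * (c * D)"
    using weight_pos [of p q \<alpha> \<beta> x v] by (intro mult_left_mono) simp_all
  also have "\<dots> = Ng * Nh * Nl * D"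
    unfolding c_def using weight_pos [of p q \<alpha> \<beta> x v] by simp
  finally show "weight p q \<alpha> \<beta> x v * \<bar>LINT s:{0..t}|lborel. LINT z|outgoing_measure. \<Phi> s z\<bar>
      \<le> Ng * Nh * Nl * D" .
qed

text \<open>
  On the left is \<open>4\<pi>\<^sup>2 p / (\<alpha> (p - 1)) (1/3 + 1/(q - 3)) \<beta>\<^sup>-\<^sup>3\<close>.  It is enough that \<open>4\<pi>\<^sup>2 \<le> 16\<pi>\<^sup>3\<close> and that
  \<open>\<beta>\<^sup>-\<^sup>3\<close> is at most \<open>\<beta>\<^sup>q\<close> for \<open>\<beta> \<ge> 1\<close> and at most \<open>\<beta>\<^sup>-\<^sup>3\<^sup>q\<close> for \<open>\<beta> \<le> 1\<close>.
\<close>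

lemma constant_bound:
  fixes p q \<alpha> \<beta> :: real
  assumes "p > 1" "q > 3" "\<alpha> > 0" "\<beta> > 0"
  shows "1 / 8 * (2 * p / (\<alpha> * (p - 1)) * (4 * pi * (4 * pi / \<beta> ^ 3 * (1 / 3 + 1 / (q - 3)))))
    \<le> 16 * p * pi ^ 3 / (\<alpha> * (p - 1)) * (1 / 3 + 1 / (q - 3)) * max (\<beta> powr q) (\<beta> powr (- 3 * q))"
proof -
  have "1 / \<beta> ^ 3 = \<beta> powr (- 3)"
    using assms by (simp add: powr_minus_divide powr_numeral)
  also have "\<dots> \<le> max (\<beta> powr q) (\<beta> powr (- 3 * q))"
  proof (cases "\<beta> \<ge> 1")
    case True
    then have "\<beta> powr (- 3) \<le> \<beta> powr q"
      using assms by (intro powr_mono) auto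
    then show ?thesis by simp
  next
    case False
    then have "\<beta> powr (- 3) \<le> \<beta> powr (- 3 * q)"
      using assms by (intro powr_mono') auto
    then show ?thesis by simp
  qed
  finally have "4 * pi ^ 2 * (1 / \<beta> ^ 3) \<le> (16 * pi ^ 3) * max (\<beta> powr q) (\<beta> powr (- 3 * q))"
  proof (rule mult_mono [rotated])
    have "4 * pi ^ 2 * 1 \<le> 4 * pi ^ 2 * (4 * pi)"
      using pi_gt3 by (intro mult_left_mono) auto
    then show "4 * pi ^ 2 \<le> 16 * pi ^ 3"
      by (simp add: power2_eq_square power3_eq_cube)
  qed (use assms in auto)
  then have "p / (\<alpha> * (p - 1)) * (1 / 3 + 1 / (q - 3)) * (4 * pi ^ 2 * (1 / \<beta> ^ 3))
      \<le> p / (\<alpha> * (p - 1)) * (1 / 3 + 1 / (q - 3)) * ((16 * pi ^ 3) * max (\<beta> powr q) (\<beta> powr (- 3 * q)))"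
    using assms by (intro mult_left_mono) auto
  moreover have "1 / 8 * (2 * p / (\<alpha> * (p - 1)) * (4 * pi * (4 * pi / \<beta> ^ 3 * (1 / 3 + 1 / (q - 3)))))
      = p / (\<alpha> * (p - 1)) * (1 / 3 + 1 / (q - 3)) * (4 * pi ^ 2 * (1 / \<beta> ^ 3))"
    by (simp add: power2_eq_square)
  ultimately show ?thesis
    by (simp only: mult_ac times_divide_eq_right times_divide_eq_left)
qed

section \<open>The trilinear estimate\<close>

theorem proposition2p1:
  fixes p q \<alpha> \<beta> T t :: real
    and g h l :: "real \<Rightarrow> real ^ 3 \<Rightarrow> real ^ 3 \<Rightarrow> real"
    and j :: nat
  assumes "p > 1" and "q > 3" and "\<alpha> > 0" and "\<beta> > 0" and "T > 0"
    and "(\<lambda>(s, x, v). g s x v) \<in> borel_measurable (lebesgue_on ({0..T} \<times> UNIV))"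
    and "(\<lambda>(s, x, v). h s x v) \<in> borel_measurable (lebesgue_on ({0..T} \<times> UNIV))"
    and "(\<lambda>(s, x, v). l s x v) \<in> borel_measurable (lebesgue_on ({0..T} \<times> UNIV))"
    and "(\<lambda>s. transport (- s) (g s)) \<in> XTspace p q \<alpha> \<beta> T"
    and "(\<lambda>s. transport (- s) (h s)) \<in> XTspace p q \<alpha> \<beta> T"
    and "(\<lambda>s. transport (- s) (l s)) \<in> XTspace p q \<alpha> \<beta> T"
    and "j \<in> {0, 1, 2, 3}"
    and "t \<in> {0..T}"
  shows "(AE (x, v) in lebesgue.
            (AE s in lebesgue. s \<in> {0..t} \<longrightarrow>
               transport (- s) (L_converges j (g s) (h s) (l s)) x v) \<and>
            set_integrable lebesgue {0..t}
              (\<lambda>s. transport (- s) (L_op j (g s) (h s) (l s)) x v)) \<and>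
         wnorm p q \<alpha> \<beta>
           (\<lambda>x v. LINT s:{0..t}|lebesgue. transport (- s) (L_op j (g s) (h s) (l s)) x v)
         \<le> ereal (16 * p * pi ^ 3 / (\<alpha> * (p - 1)) * (1 / 3 + 1 / (q - 3))
                   * max (\<beta> powr q) (\<beta> powr (- 3 * q)))
           * wnormT p q \<alpha> \<beta> T (\<lambda>s. transport (- s) (g s))
           * wnormT p q \<alpha> \<beta> T (\<lambda>s. transport (- s) (h s))
           * wnormT p q \<alpha> \<beta> T (\<lambda>s. transport (- s) (l s))"
proof -
  let ?D = "2 * p / (\<alpha> * (p - 1)) * (4 * pi * (4 * pi / \<beta> ^ 3 * (1 / 3 + 1 / (q - 3))))"
  let ?C = "16 * p * pi ^ 3 / (\<alpha> * (p - 1)) * (1 / 3 + 1 / (q - 3))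
    * max (\<beta> powr q) (\<beta> powr (- 3 * q))"
  have tT: "{0..t} \<subseteq> {0..T}"
    using assms(13) by auto
  obtain Ng where Ng: "Ng \<ge> 0" "wnormT p q \<alpha> \<beta> T (\<lambda>s. transport (- s) (g s)) = ereal Ng"
    using wnormT_finite [OF assms(9)] assms(5) by auto
  obtain Nh where Nh: "Nh \<ge> 0" "wnormT p q \<alpha> \<beta> T (\<lambda>s. transport (- s) (h s)) = ereal Nh"
    using wnormT_finite [OF assms(10)] assms(5) by auto
  obtain Nl where Nl: "Nl \<ge> 0" "wnormT p q \<alpha> \<beta> T (\<lambda>s. transport (- s) (l s)) = ereal Nl"
    using wnormT_finite [OF assms(11)] assms(5) by auto
  obtain g' where g': "g' \<in> borel_measurable borel"
      "\<And>s y w. weight p q \<alpha> \<beta> (y - s *\<^sub>R w) w * \<bar>g' (s, y, w)\<bar> \<le> Ng"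
      "AE (s, y, w) in lborel. s \<in> {0..T} \<longrightarrow> g s y w = g' (s, y, w)"
    using Borel_representative [OF assms(6) Ng(1) AE_le_wnormT [OF Ng(2)]] by blast
  obtain h' where h': "h' \<in> borel_measurable borel"
      "\<And>s y w. weight p q \<alpha> \<beta> (y - s *\<^sub>R w) w * \<bar>h' (s, y, w)\<bar> \<le> Nh"
      "AE (s, y, w) in lborel. s \<in> {0..T} \<longrightarrow> h s y w = h' (s, y, w)"
    using Borel_representative [OF assms(7) Nh(1) AE_le_wnormT [OF Nh(2)]] by blast
  obtain l' where l': "l' \<in> borel_measurable borel"
      "\<And>s y w. weight p q \<alpha> \<beta> (y - s *\<^sub>R w) w * \<bar>l' (s, y, w)\<bar> \<le> Nl"
      "AE (s, y, w) in lborel. s \<in> {0..T} \<longrightarrow> l s y w = l' (s, y, w)"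
    using Borel_representative [OF assms(8) Nl(1) AE_le_wnormT [OF Nl(2)]] by blast
  define \<Phi> where "\<Phi> = collision_integrand j g' h' l'"
  \<comment> \<open>\<open>\<Phi>\<close> and \<open>Q\<close> replace the collision integrand and \<open>8 L\<^sub>j(g, h, l)\<close> along the characteristic of \<open>z = (x, v)\<close>.\<close>
  define Q where "Q z s = (LINT y|outgoing_measure. \<Phi> z s y)" for z s
  note \<Phi> = collision_integrand_integrable [OF assms(1-4) assms(12) Ng(1) Nh(1) Nl(1) g'(1) h'(1) l'(1)
      g'(2) h'(2) l'(2), folded \<Phi>_def, folded Q_def]
  have \<Phi>_meas [measurable]: "(\<lambda>(z, s, y). \<Phi> z s y) \<in> borel_measurable (lborel \<Otimes>\<^sub>M lborel \<Otimes>\<^sub>M outgoing_measure)"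
  proof -
    have "sets (lborel \<Otimes>\<^sub>M lborel \<Otimes>\<^sub>M outgoing_measure)
        = sets (((borel :: R3 measure) \<Otimes>\<^sub>M (borel :: R3 measure)) \<Otimes>\<^sub>M (borel :: real measure) \<Otimes>\<^sub>M
          (borel :: R3 measure) \<Otimes>\<^sub>M (borel :: R3 measure))"
      by (intro sets_pair_measure_cong) (simp_all only: sets_lborel sets_sphere_measure borel_prod)
    from measurable_cong_sets [OF this refl] measurable_collision_integrand [OF g'(1) h'(1) l'(1), of j]
    show ?thesis
      unfolding \<Phi>_def by blast
  qed
  have Q_meas [measurable]: "(\<lambda>(z, s). Q z s) \<in> borel_measurable (lborel \<Otimes>\<^sub>M lborel)"
  proof -
    have "(\<lambda>(w, y). (fst w, snd w, y)) \<in> (lborel \<Otimes>\<^sub>M lborel) \<Otimes>\<^sub>M outgoing_measure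
        \<rightarrow>\<^sub>M lborel \<Otimes>\<^sub>M lborel \<Otimes>\<^sub>M outgoing_measure"
      by measurable
    from measurable_compose [OF this \<Phi>_meas]
    have "(\<lambda>(w, y). \<Phi> (fst w) (snd w) y) \<in> borel_measurable ((lborel \<Otimes>\<^sub>M lborel) \<Otimes>\<^sub>M outgoing_measure)"
      by (simp add: split_beta')
    from sigma_finite_measure.borel_measurable_lebesgue_integral [OF sigma_finite_outgoing_measure this] show ?thesis
      by (simp add: Q_def split_beta')
  qed
  have slice: "\<Phi> z s \<in> borel_measurable outgoing_measure" for z s
    using measurable_compose [OF _ \<Phi>_meas, of "\<lambda>y. (z, s, y)" outgoing_measure] by simp
  \<comment> \<open>A Borel function of \<open>(x, v)\<close> that equals the time integral of the theorem almost everywhere.\<close>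
  define H where "H z = (LINT s:{0..t}|lborel. 1 / 8 * Q z s)" for z
  have H_meas: "H \<in> borel_measurable lborel"
    unfolding H_def set_lebesgue_integral_def by measurable
  have good: "AE (x, v) in lborel.
      (AE s in lebesgue. s \<in> {0..t} \<longrightarrow> transport (- s) (L_converges j (g s) (h s) (l s)) x v) \<and>
      set_integrable lebesgue {0..t} (\<lambda>s. transport (- s) (L_op j (g s) (h s) (l s)) x v) \<and>
      (LINT s:{0..t}|lebesgue. transport (- s) (L_op j (g s) (h s) (l s)) x v) = H (x, v)"
    using AE_representative_integrand [OF assms(12) g'(3) h'(3) l'(3), folded \<Phi>_def]
  proof eventually_elim
    case (elim xv)
    obtain x v where xv: "xv = (x, v)" by (cases xv)
    let ?\<delta> = "\<lambda>s. delta_integrand (L_density j (g s (x + s *\<^sub>R v)) (h s (x + s *\<^sub>R v)) (l s (x + s *\<^sub>R v))) v"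
    have ae: "AE s in lborel. s \<in> {0..T} \<longrightarrow> (AE z in outgoing_measure. ?\<delta> s z = \<Phi> (x, v) s z)"
      using elim by (simp add: xv)
    have conv: "AE s in lborel. s \<in> {0..t} \<longrightarrow> transport (- s) (L_converges j (g s) (h s) (l s)) x v"
      using ae \<Phi>(1) [of t x v]
    proof eventually_elim
      case (elim s)
      show ?case
      proof
        assume s: "s \<in> {0..t}"
        with elim tT have "AE z in outgoing_measure. ?\<delta> s z = \<Phi> (x, v) s z"
          and "integrable outgoing_measure (\<Phi> (x, v) s)"
          by auto
        then show "transport (- s) (L_converges j (g s) (h s) (l s)) x v"
          using completion_AE_eq(1) [OF slice]
          by (simp add: transport_def L_converges_def collision_measure_def)
      qed
    qed
    have eq: "AE s in lborel. indicator {0..t} s *\<^sub>R transport (- s) (L_op j (g s) (h s) (l s)) x v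
        = indicator {0..t} s *\<^sub>R (1 / 8 * Q (x, v) s)"
      using ae
    proof eventually_elim
      case (elim s)
      show ?case
      proof (cases "s \<in> {0..t}")
        case True
        with elim tT have "AE z in outgoing_measure. ?\<delta> s z = \<Phi> (x, v) s z"
          by auto
        from completion_AE_eq(2) [OF slice this] show ?thesis
          by (simp add: transport_def L_op_def delta_integral_def collision_measure_def Q_def)
      qed simp
    qed
    have m: "(\<lambda>s. indicator {0..t} s *\<^sub>R (1 / 8 * Q (x, v) s)) \<in> borel_measurable lborel"
      by measurable
    have "integrable lborel (\<lambda>s. indicator {0..t} s *\<^sub>R (1 / 8 * Q (x, v) s))"
      using set_integrable_mult_right [OF \<Phi>(2) [of t x v], of "1 / 8"] by (simp add: set_integrable_def)
    then have "set_integrable lebesgue {0..t} (\<lambda>s. transport (- s) (L_op j (g s) (h s) (l s)) x v)"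
      unfolding set_integrable_def using completion_AE_eq(1) [OF m eq] by simp
    moreover have "(LINT s:{0..t}|lebesgue. transport (- s) (L_op j (g s) (h s) (l s)) x v) = H (x, v)"
      unfolding set_lebesgue_integral_def H_def by (rule completion_AE_eq(2) [OF m eq])
    ultimately show ?case
      using conv by (simp add: xv AE_completion)
  qed
  let ?I = "\<lambda>x v. LINT s:{0..t}|lebesgue. transport (- s) (L_op j (g s) (h s) (l s)) x v"
  have "wnorm p q \<alpha> \<beta> ?I \<le> ereal (?C * (Ng * Nh * Nl))"
  proof (rule wnorm_le)
    have "AE z in lebesgue. H z = (case z of (x, v) \<Rightarrow> ?I x v)"
      by (rule AE_completion) (use good in eventually_elim, auto)
    moreover have "H \<in> borel_measurable lebesgue"
      by (rule measurable_completion [OF H_meas])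
    ultimately show "(\<lambda>(x, v). ?I x v) \<in> borel_measurable lebesgue"
      by (rule borel_measurable_AE [rotated])
    have "weight p q \<alpha> \<beta> x v * \<bar>H (x, v)\<bar> \<le> ?C * (Ng * Nh * Nl)" for x v
    proof -
      have "H (x, v) = 1 / 8 * (LINT s:{0..t}|lborel. Q (x, v) s)"
        unfolding H_def by (rule set_integral_mult_right)
      then have "weight p q \<alpha> \<beta> x v * \<bar>H (x, v)\<bar>
          = 1 / 8 * (weight p q \<alpha> \<beta> x v * \<bar>LINT s:{0..t}|lborel. Q (x, v) s\<bar>)"
        by (simp only: abs_mult)
      also have "\<dots> \<le> 1 / 8 * (Ng * Nh * Nl * ?D)"
        by (intro mult_left_mono \<Phi>(3)) simp
      also have "\<dots> = (1 / 8 * ?D) * (Ng * Nh * Nl)"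
        by simp
      also have "\<dots> \<le> ?C * (Ng * Nh * Nl)"
        by (intro mult_right_mono constant_bound assms mult_nonneg_nonneg Ng Nh Nl)
      finally show ?thesis .
    qed
    then show "AE (x, v) in lebesgue. weight p q \<alpha> \<beta> x v * \<bar>?I x v\<bar> \<le> ?C * (Ng * Nh * Nl)"
      by (intro AE_completion) (use good in eventually_elim, auto)
  qed
  moreover have "AE (x, v) in lebesgue.
      (AE s in lebesgue. s \<in> {0..t} \<longrightarrow> transport (- s) (L_converges j (g s) (h s) (l s)) x v) \<and>
      set_integrable lebesgue {0..t} (\<lambda>s. transport (- s) (L_op j (g s) (h s) (l s)) x v)"
    by (rule AE_completion) (use good in eventually_elim, auto)
  ultimately show ?thesis
    unfolding Ng(2) Nh(2) Nl(2) by (simp add: mult.assoc)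
qed

end
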